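(* Let $d,L\ge 1$ be integers, let $C>0$, let $\varepsilon\in(0,1)$, and let $\mathbf{Y}^0\in L^2(\mathbb{R}^d)$ be an input. Put $$\omega_c:=\Omega_\varepsilon^\sharp(L):=\inf\Bigl\{\Omega>0:\; C^{2L}\int_{|\xi|>\Omega}(1+|\xi|)^{-2L}\,|\widehat{\mathbf{Y}^0}(\xi)|^2\,d\xi\le\varepsilon\,\|\mathbf{Y}^0\|_2^2\Bigr\}.$$ Let $\mathbf{Y}\in L^2(\mathbb{R}^d)$ be any target, and set $\mathbf{Y}_{\text{low}}=P_{\mathcal{B}_{\omega_c}}(\mathbf{Y})$ and $\mathbf{Y}_{\text{high}}=P_{\mathcal{B}_{\omega_c}^{\perp}}(\mathbf{Y})=\mathbf{Y}-\mathbf{Y}_{\text{low}}$. Then for every output $\mathbf{Y}^t$ of a depth-$L$ CNN (with envelope constant $C$) with input $\mathbf{Y}^0$, $$\|\mathbf{Y}-\mathbf{Y}^t\|_2\;\ge\;\bigl[\,\|\mathbf{Y}_{\text{high}}\|_2-\sqrt{\varepsilon}\,\|\mathbf{Y}^0\|_2\,\bigr]_+ .$$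
   Context: The Fourier transform $\widehat{f}=\mathcal{F}f$ is normalized to be unitary on $L^2(\mathbb{R}^d)$, e.g. $\widehat f(\xi)=\int f(x)e^{-2\pi i x\cdot\xi}\,dx$ for integrable $f$. For a cutoff $\omega_c$, $\mathcal{B}_{\omega_c}=\{f\in L^2(\mathbb{R}^d):\operatorname{supp}\widehat f\subseteq\{|\xi|\le\omega_c\}\}$, with orthogonal complement $\mathcal{B}_{\omega_c}^\perp$; the orthogonal projections are $P_{\mathcal{B}_{\omega_c}}f=\mathcal{F}^{-1}(\mathbf{1}_{\{|\xi|\le\omega_c\}}\widehat f)$ and $P_{\mathcal{B}_{\omega_c}^\perp}f=f-P_{\mathcal{B}_{\omega_c}}f$. Notation: $[x]_+=\max(x,0)$. A depth-$L$ CNN is modeled as $L$ consecutive convolutions with kernels $k_1,\dots,k_L\in L^1(\mathbb{R}^d)$, each compactly supported and of finite total variation ($k_\ell\in BV(\mathbb{R}^d)$). Its composite frequency response is $H_L(\xi)=\prod_{\ell=1}^L\widehat{k_\ell}(\xi)$. It has envelope constant $C$ if $|H_L(\xi)|\le C^L(1+|\xi|)^{-L}$ for all $\xi\in\mathbb{R}^d$. The output of the CNN on input $f\in L^2(\mathbb{R}^d)$ is the function $g\in L^2(\mathbb{R}^d)$ with $\widehat g=H_L\,\widehat f$. *)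

theory Defs
  imports "HOL-Analysis.Analysis"
begin

section \<open>The space \<open>L\<^sup>2\<close> and the Fourier transform\<close>

text \<open>
  Elements of \<open>L\<^sup>2\<close> are represented by Borel functions (every almost-everywhere class contains
  one); identities between them are understood almost everywhere.
\<close>

definition L2 :: "('a::euclidean_space \<Rightarrow> complex) set" where
  "L2 = {f \<in> borel_measurable lborel. integrable lborel (\<lambda>x. (norm (f x))\<^sup>2)}"

definition L2_norm :: "('a::euclidean_space \<Rightarrow> complex) \<Rightarrow> real" where
  "L2_norm f = sqrt (LINT x|lborel. (norm (f x))\<^sup>2)"

definition fourier_L1 :: "('a::euclidean_space \<Rightarrow> complex) \<Rightarrow> 'a \<Rightarrow> complex" where
  "fourier_L1 f \<xi> = (LINT x|lborel. f x * exp (- (2 * of_real pi * \<i> * of_real (x \<bullet> \<xi>))))"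

text \<open>
  The unitary transform on \<open>L\<^sup>2\<close>, which extends \<^const>\<open>fourier_L1\<close> from \<open>L\<^sup>1 \<inter> L\<^sup>2\<close>: a function
  in \<open>L\<^sup>2\<close> is the \<open>L\<^sup>2\<close> limit of its truncations to balls, which are integrable, and its transform
  is the \<open>L\<^sup>2\<close> limit of their Fourier integrals. The limit is unique up to null sets.  The
  nonnegative integral is used because, unlike the Bochner integral, it does not vanish on
  functions that are not square integrable.
\<close>

definition fourier_L2 :: "('a::euclidean_space \<Rightarrow> complex) \<Rightarrow> 'a \<Rightarrow> complex" where
  "fourier_L2 f = (SOME g. g \<in> L2 \<and>
     (\<lambda>n. \<integral>\<^sup>+\<xi>. ennreal ((norm (g \<xi> - fourier_L1 (\<lambda>x. indicator (cball 0 (real n)) x * f x) \<xi>))\<^sup>2)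
        \<partial>lborel) \<longlonglongrightarrow> 0)"

definition inv_fourier_L2 :: "('a::euclidean_space \<Rightarrow> complex) \<Rightarrow> 'a \<Rightarrow> complex" where
  "inv_fourier_L2 g = (SOME f. f \<in> L2 \<and> (AE \<xi> in lborel. fourier_L2 f \<xi> = g \<xi>))"

text \<open>
  The orthogonal projections onto the space of all \<open>f \<in> L\<^sup>2\<close> whose transform is supported in the
  closed ball of radius \<open>\<omega>\<close>, and onto its orthogonal complement.
\<close>

definition proj_low :: "real \<Rightarrow> ('a::euclidean_space \<Rightarrow> complex) \<Rightarrow> 'a \<Rightarrow> complex" where
  "proj_low \<omega> f = inv_fourier_L2 (\<lambda>\<xi>. indicator {\<xi>. norm \<xi> \<le> \<omega>} \<xi> * fourier_L2 f \<xi>)"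

definition proj_high :: "real \<Rightarrow> ('a::euclidean_space \<Rightarrow> complex) \<Rightarrow> 'a \<Rightarrow> complex" where
  "proj_high \<omega> f = (\<lambda>x. f x - proj_low \<omega> f x)"


section \<open>Functions of bounded variation\<close>

definition divergence :: "('a::euclidean_space \<Rightarrow> 'a) \<Rightarrow> 'a \<Rightarrow> real" where
  "divergence \<phi> x = (\<Sum>b\<in>Basis. frechet_derivative \<phi> (at x) b \<bullet> b)"

text \<open>Compactly supported \<open>C\<^sup>1\<close> vector fields of supremum norm at most one.\<close>

definition test_fields :: "('a::euclidean_space \<Rightarrow> 'a) set" where
  "test_fields = {\<phi>. (\<forall>x. \<phi> differentiable (at x))
     \<and> (\<forall>v. continuous_on UNIV (\<lambda>x. frechet_derivative \<phi> (at x) v))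
     \<and> compact (closure {x. \<phi> x \<noteq> 0})
     \<and> (\<forall>x. norm (\<phi> x) \<le> 1)}"

definition total_variation :: "('a::euclidean_space \<Rightarrow> real) \<Rightarrow> ereal" where
  "total_variation k = (SUP \<phi>\<in>test_fields. ereal (LINT x|lborel. k x * divergence \<phi> x))"

text \<open>A complex-valued function has bounded variation iff both of its real components do.\<close>

definition BV :: "('a::euclidean_space \<Rightarrow> complex) set" where
  "BV = {k. integrable lborel k
     \<and> total_variation (\<lambda>x. Re (k x)) < \<infinity> \<and> total_variation (\<lambda>x. Im (k x)) < \<infinity>}"


section \<open>Convolutional networks\<close>

definition cnn_kernel :: "('a::euclidean_space \<Rightarrow> complex) \<Rightarrow> bool" where
  "cnn_kernel k \<longleftrightarrow> integrable lborel k \<and> k \<in> BV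
     \<and> (\<exists>K. compact K \<and> (AE x in lborel. x \<notin> K \<longrightarrow> k x = 0))"

definition freq_response :: "nat \<Rightarrow> (nat \<Rightarrow> 'a::euclidean_space \<Rightarrow> complex) \<Rightarrow> 'a \<Rightarrow> complex" where
  "freq_response L k \<xi> = (\<Prod>l=1..L. fourier_L1 (k l) \<xi>)"

definition has_envelope :: "real \<Rightarrow> nat \<Rightarrow> (nat \<Rightarrow> 'a::euclidean_space \<Rightarrow> complex) \<Rightarrow> bool" where
  "has_envelope C L k \<longleftrightarrow> (\<forall>\<xi>. norm (freq_response L k \<xi>) \<le> C ^ L / (1 + norm \<xi>) ^ L)"

definition is_cnn_output ::
  "nat \<Rightarrow> (nat \<Rightarrow> 'a::euclidean_space \<Rightarrow> complex) \<Rightarrow> ('a \<Rightarrow> complex) \<Rightarrow> ('a \<Rightarrow> complex) \<Rightarrow> bool" where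
  "is_cnn_output L k f g \<longleftrightarrow>
     g \<in> L2 \<and> (AE \<xi> in lborel. fourier_L2 g \<xi> = freq_response L k \<xi> * fourier_L2 f \<xi>)"

definition cutoff :: "real \<Rightarrow> nat \<Rightarrow> real \<Rightarrow> ('a::euclidean_space \<Rightarrow> complex) \<Rightarrow> real" where
  "cutoff C L \<epsilon> f = Inf {\<Omega>. \<Omega> > 0 \<and>
     C ^ (2 * L) * (LINT \<xi>:{\<xi>. norm \<xi> > \<Omega>}|lborel. (norm (fourier_L2 f \<xi>))\<^sup>2 / (1 + norm \<xi>) ^ (2 * L))
       \<le> \<epsilon> * (L2_norm f)\<^sup>2}"

end

theory Submission
  imports Defs "HOL-Probability.Characteristic_Functions"
begin

text \<open>
  By Plancherel, the distance of \<open>Y\<close> to \<open>Y\<^sup>t\<close> is at least the norm of the difference of the transforms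
  outside the ball of radius \<open>\<omega>\<^sub>c\<close>. There \<open>Y\<close> contributes exactly the norm of its high-frequency part,
  and the envelope bounds the contribution of \<open>Y\<^sup>t\<close> by the tail that defines the cutoff.

  Plancherel on \<open>L\<^sup>1 \<inter> L\<^sup>2\<close> comes from the identity
  \<open>\<integral> |\<F> f \<xi>|\<^sup>2 e\<^bsup>-\<pi>|t\<xi>|\<^sup>2\<^esup> d\<xi> = \<integral> f(x) \<integral> cnj (f (x - t y)) e\<^bsup>-\<pi>|y|\<^sup>2\<^esup> dy dx\<close>. Its right-hand side is at most \<open>\<parallel>f\<parallel>\<^sup>2\<close>,
  so the transform is a contraction. As \<open>t \<rightarrow> 0\<close> it tends to \<open>\<parallel>f\<parallel>\<^sup>2\<close> when \<open>f\<close> is continuous and bounded, and such functions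
  are dense. Fourier inversion, needed for the projections, follows from the isometry and the
  symmetry \<open>\<integral> (\<F> f) h = \<integral> f (\<F> h)\<close>.
\<close>

section \<open>The Gaussian and its Fourier transform\<close>

text \<open>The character exp(-2 pi i t): \<open>wave (x \<bullet> \<xi>)\<close> is the kernel of
  \<open>fourier_L1\<close>, and in this form it is unimodular and multiplicative.\<close>

definition wave :: "real \<Rightarrow> complex" where
  "wave t = cis (- (2 * pi * t))"

lemma norm_wave [simp]: "norm (wave t) = 1"
  and wave_0 [simp]: "wave 0 = 1"
  and wave_add: "wave (s + t) = wave s * wave t"
  and cnj_wave: "cnj (wave t) = wave (- t)"
  by (auto simp: wave_def cis_mult cis_cnj algebra_simps)

lemma wave_sum: "finite I \<Longrightarrow> wave (sum f I) = (\<Prod>i\<in>I. wave (f i))"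
  by (induct I rule: finite_induct) (auto simp: wave_add)

lemma continuous_on_wave [continuous_intros]:
  "continuous_on S f \<Longrightarrow> continuous_on S (\<lambda>x. wave (f x))"
  unfolding wave_def by (intro continuous_intros)

lemma borel_measurable_wave [measurable]: "wave \<in> borel_measurable borel"
  by (intro borel_measurable_continuous_onI continuous_intros)

lemma fourier_L1_wave: "fourier_L1 f \<xi> = (LINT x|lborel. f x * wave (x \<bullet> \<xi>))"
  by (simp add: fourier_L1_def wave_def cis_conv_exp mult_ac)

text \<open>The constant pi makes this Gaussian have total mass 1 and be its own Fourier transform
  in the unitary normalization.\<close>

definition gauss :: "'a::euclidean_space \<Rightarrow> real" where
  "gauss x = exp (- (pi * (norm x)\<^sup>2))"

lemma gauss_nonneg [simp]: "0 \<le> gauss x" and gauss_le_1: "gauss x \<le> 1"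
  by (auto simp: gauss_def)

lemma continuous_on_gauss [continuous_intros]:
  "continuous_on S f \<Longrightarrow> continuous_on S (\<lambda>x. gauss (f x))"
  unfolding gauss_def by (intro continuous_intros)

lemma borel_measurable_gauss [measurable]: "gauss \<in> borel_measurable borel"
  unfolding gauss_def by measurable

text \<open>This is the characteristic function of the standard normal distribution after a
  rescaling of the variable.\<close>

lemma has_bochner_integral_gauss_wave_real:
  fixes s :: real
  shows "has_bochner_integral lborel (\<lambda>x. complex_of_real (gauss x) * wave (x * s)) (of_real (gauss s))"
proof -
  \<comment> \<open>Substituting c x turns exp(-y^2/2) into exp(-pi x^2) and cancels the factor
    1/sqrt(2 pi) of the density. The argument t is chosen so that t (c x) = -2 pi x s.\<close>
  define c where "c = sqrt (2 * pi)"
  have c: "c > 0" "c\<^sup>2 = 2 * pi" by (simp_all add: c_def)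
  define t where "t = - (c * s)"
  let ?f = "\<lambda>x. std_normal_density x *\<^sub>R cis (t * x)"
  interpret real_distribution std_normal_distribution by (rule real_dist_normal_dist)
  have [measurable]: "(\<lambda>x. cis (t * x)) \<in> borel_measurable borel"
    by (intro borel_measurable_continuous_onI continuous_intros)
  have "integrable std_normal_distribution (\<lambda>x. iexp (t * x))"
    by (rule integrable_iexp) simp_all
  then have "integrable std_normal_distribution (\<lambda>x. cis (t * x))"
    by (simp add: cis_conv_exp)
  then have "integrable lborel ?f"
    by (subst (asm) integrable_density) auto
  moreover have "integral\<^sup>L lborel ?f = of_real (exp (- (t^2) / 2))"
    using fun_cong[OF char_std_normal_distribution, of t]
    by (simp add: char_def integral_density flip: cis_conv_exp of_real_mult)
  ultimately have "has_bochner_integral lborel ?f (of_real (exp (- (t^2) / 2)))"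
    by (simp add: has_bochner_integral_iff)
  then have "has_bochner_integral lborel (\<lambda>x. ?f (0 + c * x)) (of_real (exp (- (t^2) / 2)) /\<^sub>R \<bar>c\<bar>)"
    using lborel_has_bochner_integral_real_affine_iff[of c ?f _ 0] c by auto
  then have "has_bochner_integral lborel (\<lambda>x. c *\<^sub>R ?f (0 + c * x))
     (c *\<^sub>R (of_real (exp (- (t^2) / 2)) /\<^sub>R \<bar>c\<bar>))"
    by (rule has_bochner_integral_scaleR_right)
  moreover have "c *\<^sub>R ?f (0 + c * x) = complex_of_real (gauss x) * wave (x * s)" for x
  proof -
    have t: "t * (c * x) = - (2 * pi * (x * s))"
      using c(2) by (simp add: t_def power2_eq_square algebra_simps)
    have "c * std_normal_density (c * x) = gauss x"
      using c by (simp add: std_normal_density_def gauss_def c_def[symmetric] power_mult_distrib)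
    then show ?thesis
      by (simp add: wave_def flip: t) (simp add: scaleR_conv_of_real flip: of_real_mult)
  qed
  moreover have "c *\<^sub>R (complex_of_real (exp (- (t^2) / 2)) /\<^sub>R \<bar>c\<bar>) = of_real (gauss s)"
    using c by (simp add: t_def gauss_def power_mult_distrib)
  ultimately show ?thesis by simp
qed

lemma gauss_eq_prod:
  fixes x :: "'a::euclidean_space"
  shows "gauss x = (\<Prod>b\<in>Basis. gauss (x \<bullet> b))"
proof -
  have "(norm x)\<^sup>2 = (\<Sum>b\<in>Basis. (x \<bullet> b)\<^sup>2)"
    by (subst power2_norm_eq_inner, subst euclidean_inner) (simp add: power2_eq_square)
  then show ?thesis
    by (simp add: gauss_def sum_distrib_left exp_sum[symmetric] sum_negf[symmetric])
qed

text \<open>Gaussian and character both factor over the coordinates, so Fubini reduces the integral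
  to one dimension. Lebesgue measure is the image of the product measure under the coordinate
  map.\<close>

lemma has_bochner_integral_gauss_wave:
  fixes \<xi> :: "'a::euclidean_space"
  shows "has_bochner_integral lborel (\<lambda>x. complex_of_real (gauss x) * wave (x \<bullet> \<xi>)) (of_real (gauss \<xi>))"
proof -
  interpret P: product_sigma_finite "\<lambda>_::'a. lborel :: real measure" by standard
  let ?P = "Pi\<^sub>M Basis (\<lambda>_::'a. lborel :: real measure)"
  let ?F = "\<lambda>b x. complex_of_real (gauss x) * wave (x * (\<xi> \<bullet> b))"
  let ?T = "\<lambda>f. \<Sum>b\<in>Basis. f b *\<^sub>R b :: 'a"
  have F: "integrable lborel (?F b)" "integral\<^sup>L lborel (?F b) = of_real (gauss (\<xi> \<bullet> b))" for b
    using has_bochner_integral_gauss_wave_real[of "\<xi> \<bullet> b"] by (simp_all only: has_bochner_integral_iff)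
  have "integrable ?P (\<lambda>x. \<Prod>b\<in>Basis. ?F b (x b))"
    by (intro P.product_integrable_prod F) simp
  moreover have "(\<integral>x. (\<Prod>b\<in>Basis. ?F b (x b)) \<partial>?P) = of_real (gauss \<xi>)"
    by (subst P.product_integral_prod) (simp_all add: F gauss_eq_prod[of \<xi>])
  moreover have "(\<Prod>b\<in>Basis. ?F b (x b)) = complex_of_real (gauss (?T x)) * wave (?T x \<bullet> \<xi>)" for x
  proof -
    have "?T x \<bullet> \<xi> = (\<Sum>b\<in>Basis. x b * (\<xi> \<bullet> b))"
      by (simp only: inner_sum_left inner_scaleR_left inner_commute[of \<xi>])
    then show ?thesis
      by (simp add: gauss_eq_prod[of "?T x"] prod.distrib wave_sum)
  qed
  ultimately have "has_bochner_integral ?P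
     (\<lambda>x. complex_of_real (gauss (?T x)) * wave (?T x \<bullet> \<xi>)) (of_real (gauss \<xi>))"
    by (simp only: has_bochner_integral_iff)
  then have "has_bochner_integral (distr ?P borel ?T)
     (\<lambda>x. complex_of_real (gauss x) * wave (x \<bullet> \<xi>)) (of_real (gauss \<xi>))"
    by (intro has_bochner_integral_distr) simp_all
  then show ?thesis by (subst lborel_eq)
qed

lemma integrable_gauss: "integrable lborel (gauss :: 'a::euclidean_space \<Rightarrow> real)"
  and integral_gauss: "(LINT x|lborel. gauss (x::'a)) = 1"
proof -
  have "has_bochner_integral lborel (\<lambda>x. complex_of_real (gauss (x::'a))) (of_real (gauss (0::'a)))"
    using has_bochner_integral_gauss_wave[of "0::'a"] by simp
  then show "integrable lborel (gauss :: 'a \<Rightarrow> real)" "(LINT x|lborel. gauss (x::'a)) = 1"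
    by (simp_all only: has_bochner_integral_iff complex_of_real_integrable_eq
        integral_complex_of_real of_real_eq_iff) (simp_all add: gauss_def)
qed

section \<open>The Hilbert space structure of \<open>L\<^sup>2\<close>\<close>

lemma L2_measurable: "f \<in> L2 \<Longrightarrow> f \<in> borel_measurable borel"
  and L2_square_integrable: "f \<in> L2 \<Longrightarrow> integrable lborel (\<lambda>x. (norm (f x))\<^sup>2)"
  by (auto simp: L2_def)

lemma L2_norm_nonneg [simp]: "0 \<le> L2_norm f"
  by (simp add: L2_norm_def)

lemma L2_norm_square: "(L2_norm f)\<^sup>2 = (LINT x|lborel. (norm (f x))\<^sup>2)"
  by (simp add: L2_norm_def)

lemma integral_mult_cnj: "(LINT x|lborel. f x * cnj (f x)) = of_real ((L2_norm f)\<^sup>2)"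
  by (simp only: complex_norm_square[symmetric] of_real_power[symmetric]
      Bochner_Integration.integral_complex_of_real L2_norm_square)

lemma L2_nn_integral:
  "f \<in> L2 \<Longrightarrow> (\<integral>\<^sup>+x. ennreal ((norm (f x))\<^sup>2) \<partial>lborel) = ennreal ((L2_norm f)\<^sup>2)"
  by (simp add: L2_norm_square nn_integral_eq_integral L2_square_integrable)

text \<open>A finite nonnegative integral gives membership and the norm bound at once, so estimates
  by Fatou or Tonelli need no prior integrability.\<close>

lemma
  assumes "f \<in> borel_measurable borel" "0 \<le> c"
    and le: "(\<integral>\<^sup>+x. ennreal ((norm (f x))\<^sup>2) \<partial>lborel) \<le> ennreal (c\<^sup>2)"
  shows L2_nn_integralI: "f \<in> L2" and L2_norm_leI: "L2_norm f \<le> c"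
proof -
  have [measurable]: "f \<in> borel_measurable borel" by fact
  show *: "f \<in> L2"
    unfolding L2_def using le_less_trans[OF le] by (auto intro!: integrableI_bounded)
  have "(L2_norm f)\<^sup>2 \<le> c\<^sup>2"
    using le L2_nn_integral[OF *] by simp
  then show "L2_norm f \<le> c"
    using \<open>0 \<le> c\<close> power2_le_imp_le by blast
qed

lemma
  assumes "g \<in> L2" "f \<in> borel_measurable borel" and le: "AE x in lborel. norm (f x) \<le> norm (g x)"
  shows L2_AE_mono: "f \<in> L2" and L2_norm_AE_mono: "L2_norm f \<le> L2_norm g"
proof -
  have "(\<integral>\<^sup>+x. ennreal ((norm (f x))\<^sup>2) \<partial>lborel) \<le> (\<integral>\<^sup>+x. ennreal ((norm (g x))\<^sup>2) \<partial>lborel)"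
    using le by (intro nn_integral_mono_AE) (auto elim!: eventually_mono intro!: ennreal_leI power_mono)
  then have "(\<integral>\<^sup>+x. ennreal ((norm (f x))\<^sup>2) \<partial>lborel) \<le> ennreal ((L2_norm g)\<^sup>2)"
    using L2_nn_integral assms by metis
  then show "f \<in> L2" "L2_norm f \<le> L2_norm g"
    using assms(2) by (blast intro: L2_nn_integralI L2_norm_leI L2_norm_nonneg)+
qed

lemma L2_norm_AE_cong:
  assumes "f \<in> L2" "g \<in> L2" "AE x in lborel. f x = g x"
  shows "L2_norm f = L2_norm g"
  using assms by (intro antisym L2_norm_AE_mono) (auto elim: eventually_mono dest: L2_measurable)

lemma L2_add: assumes "f \<in> L2" "g \<in> L2" shows "(\<lambda>x. f x + g x) \<in> L2"
proof -
  have [measurable]: "f \<in> borel_measurable borel" "g \<in> borel_measurable borel"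
    using assms by (auto dest: L2_measurable)
  have "integrable lborel (\<lambda>x. 2 * (norm (f x))\<^sup>2 + 2 * (norm (g x))\<^sup>2)"
    by (intro Bochner_Integration.integrable_add integrable_mult_right assms L2_square_integrable)
  then have "integrable lborel (\<lambda>x. (norm (f x + g x))\<^sup>2)"
  proof (rule Bochner_Integration.integrable_bound)
    have "(norm (f x + g x))\<^sup>2 \<le> 2 * (norm (f x))\<^sup>2 + 2 * (norm (g x))\<^sup>2" for x
    proof -
      have "(norm (f x + g x))\<^sup>2 \<le> (norm (f x) + norm (g x))\<^sup>2"
        by (intro power_mono norm_triangle_ineq) simp
      also have "\<dots> \<le> 2 * (norm (f x))\<^sup>2 + 2 * (norm (g x))\<^sup>2"
        using sum_squares_bound[of "norm (f x)" "norm (g x)"] by (simp add: power2_sum)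
      finally show ?thesis .
    qed
    then show "AE x in lborel. norm ((norm (f x + g x))\<^sup>2) \<le> norm (2 * (norm (f x))\<^sup>2 + 2 * (norm (g x))\<^sup>2)"
      by simp
  qed measurable
  then show ?thesis by (simp add: L2_def)
qed

lemma L2_cmult: assumes "f \<in> L2" shows "(\<lambda>x. c * f x) \<in> L2"
  using L2_measurable[OF assms] L2_square_integrable[OF assms]
  by (simp add: L2_def norm_mult power_mult_distrib)

lemma L2_diff: "f \<in> L2 \<Longrightarrow> g \<in> L2 \<Longrightarrow> (\<lambda>x. f x - g x) \<in> L2"
  using L2_add[of f "\<lambda>x. (-1) * g x"] L2_cmult[of g "-1"] by simp

lemma borel_measurable_cnj [measurable]: "cnj \<in> borel_measurable borel"
  by (intro borel_measurable_continuous_onI continuous_intros)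

lemma L2_cnj: "f \<in> L2 \<Longrightarrow> (\<lambda>x. cnj (f x)) \<in> L2"
  by (simp add: L2_def measurable_compose[OF _ borel_measurable_cnj])

lemma L2_norm_minus_commute: "L2_norm (\<lambda>x. f x - g x) = L2_norm (\<lambda>x. g x - f x)"
  by (simp add: L2_norm_def norm_minus_commute)

lemma L2_indicator:
  assumes "f \<in> L2" "A \<in> sets borel"
  shows "(\<lambda>x. indicator A x * f x) \<in> L2"
    and "L2_norm (\<lambda>x. indicator A x * f x) \<le> L2_norm f"
proof -
  have [measurable]: "f \<in> borel_measurable borel" "A \<in> sets borel"
    using assms by (simp_all add: L2_measurable)
  have "AE x in lborel. norm (indicator A x * f x) \<le> norm (f x)"
    by (simp add: indicator_def)
  then show "(\<lambda>x. indicator A x * f x) \<in> L2" "L2_norm (\<lambda>x. indicator A x * f x) \<le> L2_norm f"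
    by (auto intro: L2_AE_mono[OF assms(1)] L2_norm_AE_mono[OF assms(1)])
qed

section \<open>Cauchy-Schwarz, the triangle inequality and completeness\<close>

lemma L2_mult_integrable: assumes "f \<in> L2" "g \<in> L2" shows "integrable lborel (\<lambda>x. f x * g x)"
proof (rule Bochner_Integration.integrable_bound)
  show "integrable lborel (\<lambda>x. (norm (f x))\<^sup>2 + (norm (g x))\<^sup>2)"
    by (intro Bochner_Integration.integrable_add assms L2_square_integrable)
  show "(\<lambda>x. f x * g x) \<in> borel_measurable lborel"
    using assms by (auto dest!: L2_measurable)
  have "norm (f x * g x) \<le> (norm (f x))\<^sup>2 + (norm (g x))\<^sup>2" for x
    using sum_squares_bound[of "norm (f x)" "norm (g x)"] mult_nonneg_nonneg[OF norm_ge_zero[of "f x"] norm_ge_zero[of "g x"]]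
    unfolding norm_mult by linarith
  then show "AE x in lborel. norm (f x * g x) \<le> norm ((norm (f x))\<^sup>2 + (norm (g x))\<^sup>2)" by simp
qed

text \<open>The discriminant of a nonnegative quadratic is not positive. The case A = 0 is separate
  because the quadratic then degenerates to a linear function.\<close>

lemma quadratic_nonneg_imp:
  fixes A P B :: real
  assumes "\<And>s. 0 \<le> s\<^sup>2 * A - 2 * s * P + B" "0 \<le> A"
  shows "P\<^sup>2 \<le> A * B"
proof (cases "A = 0")
  case True
  have "P = 0"
  proof (rule ccontr)
    assume "P \<noteq> 0"
    \<comment> \<open>At this s the linear function takes the value -1.\<close>
    then show False using assms(1)[of "(B + 1) / (2 * P)"] True by simp
  qed
  then show ?thesis using True by simp
next
  case False
  then have "0 < A" using assms by simp
  \<comment> \<open>The quadratic is evaluated at its minimum s = P / A.\<close>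
  then have "0 \<le> A * ((P / A)\<^sup>2 * A - 2 * (P / A) * P + B)"
    using assms(1)[of "P / A"] by (intro mult_nonneg_nonneg) simp_all
  also have "\<dots> = A * B - P\<^sup>2"
    using \<open>0 < A\<close> by (simp add: field_simps power2_eq_square)
  finally show ?thesis by simp
qed

text \<open>The integral of (s |f| - |g|)^2 is a nonnegative quadratic in s, and its discriminant
  gives the bound.\<close>

lemma L2_Cauchy_Schwarz:
  assumes "f \<in> L2" "g \<in> L2"
  shows "(LINT x|lborel. norm (f x * g x)) \<le> L2_norm f * L2_norm g"
    and "norm (LINT x|lborel. f x * g x) \<le> L2_norm f * L2_norm g"
proof -
  define P where "P = (LINT x|lborel. norm (f x * g x))"
  note int = L2_mult_integrable[OF assms] assms[THEN L2_square_integrable]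
  have "0 \<le> s\<^sup>2 * (L2_norm f)\<^sup>2 - 2 * s * P + (L2_norm g)\<^sup>2" for s
  proof -
    have "0 \<le> (LINT x|lborel. (s * norm (f x) - norm (g x))\<^sup>2)" by simp
    also have "\<dots> = (LINT x|lborel. s\<^sup>2 * (norm (f x))\<^sup>2 - 2 * s * norm (f x * g x) + (norm (g x))\<^sup>2)"
      by (intro Bochner_Integration.integral_cong) (auto simp: norm_mult power2_eq_square algebra_simps)
    also have "\<dots> = s\<^sup>2 * (L2_norm f)\<^sup>2 - 2 * s * P + (L2_norm g)\<^sup>2"
      using int by (simp add: L2_norm_square P_def)
    finally show ?thesis .
  qed
  then have "P\<^sup>2 \<le> (L2_norm f)\<^sup>2 * (L2_norm g)\<^sup>2"
    by (rule quadratic_nonneg_imp) simp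
  then show *: "(LINT x|lborel. norm (f x * g x)) \<le> L2_norm f * L2_norm g"
    unfolding P_def[symmetric] power_mult_distrib[symmetric] by (rule power2_le_imp_le) simp
  show "norm (LINT x|lborel. f x * g x) \<le> L2_norm f * L2_norm g"
    using integral_norm_bound[of lborel "\<lambda>x. f x * g x"] * by linarith
qed

lemma L2_norm_triangle:
  assumes "f \<in> L2" "g \<in> L2"
  shows "L2_norm (\<lambda>x. f x + g x) \<le> L2_norm f + L2_norm g"
proof (rule power2_le_imp_le)
  note int = L2_mult_integrable[OF assms] assms[THEN L2_square_integrable]
  have "(L2_norm (\<lambda>x. f x + g x))\<^sup>2 \<le>
      (LINT x|lborel. (norm (f x))\<^sup>2 + (norm (g x))\<^sup>2 + 2 * norm (f x * g x))"
    unfolding L2_norm_square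
  proof (rule integral_mono)
    show "(norm (f x + g x))\<^sup>2 \<le> (norm (f x))\<^sup>2 + (norm (g x))\<^sup>2 + 2 * norm (f x * g x)" for x
      using power_mono[OF norm_triangle_ineq[of "f x" "g x"], of 2] by (simp add: power2_sum norm_mult)
  qed (use int L2_square_integrable[OF L2_add[OF assms]] in auto)
  also have "\<dots> = (L2_norm f)\<^sup>2 + (L2_norm g)\<^sup>2 + 2 * (LINT x|lborel. norm (f x * g x))"
    using int by (simp add: L2_norm_square)
  also have "\<dots> \<le> (L2_norm f)\<^sup>2 + (L2_norm g)\<^sup>2 + 2 * (L2_norm f * L2_norm g)"
    using L2_Cauchy_Schwarz(1)[OF assms] by simp
  finally show "(L2_norm (\<lambda>x. f x + g x))\<^sup>2 \<le> (L2_norm f + L2_norm g)\<^sup>2"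
    by (simp add: power2_sum)
qed simp

lemma L2_norm_triangle_diff:
  assumes "f \<in> L2" "g \<in> L2" "h \<in> L2"
  shows "L2_norm (\<lambda>x. f x - h x) \<le> L2_norm (\<lambda>x. f x - g x) + L2_norm (\<lambda>x. g x - h x)"
  using L2_norm_triangle[OF L2_diff[OF assms(1,2)] L2_diff[OF assms(2,3)]] by simp

lemma L2_norm_diff_triangle:
  assumes "f \<in> L2" "g \<in> L2"
  shows "\<bar>L2_norm f - L2_norm g\<bar> \<le> L2_norm (\<lambda>x. f x - g x)"
proof -
  have "L2_norm f \<le> L2_norm (\<lambda>x. f x - g x) + L2_norm g"
    using L2_norm_triangle[OF L2_diff[OF assms] assms(2)] by simp
  moreover have "L2_norm g \<le> L2_norm (\<lambda>x. g x - f x) + L2_norm f"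
    using L2_norm_triangle[OF L2_diff[OF assms(2,1)] assms(1)] by simp
  ultimately show ?thesis using L2_norm_minus_commute[of f g] by linarith
qed

lemma L2_norm_eq_0:
  assumes "f \<in> L2" "L2_norm f = 0"
  shows "AE x in lborel. f x = 0"
proof -
  have "(LINT x|lborel. (norm (f x))\<^sup>2) = 0"
    using assms(2) L2_norm_square[of f] by simp
  then have "AE x in lborel. (norm (f x))\<^sup>2 = 0"
    using L2_square_integrable[OF assms(1)] by (subst (asm) integral_nonneg_eq_0_iff_AE) auto
  then show ?thesis by simp
qed

text \<open>The weighted sum of squares bounds the sum of the increments through
  \<open>a \<le> 2\<^sup>k a\<^sup>2 + 2\<^sup>-\<^sup>k\<close>, which avoids Minkowski's inequality for series.\<close>

lemma L2_complete:
  fixes F :: "nat \<Rightarrow> 'a::euclidean_space \<Rightarrow> complex"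
  assumes F: "\<And>n. F n \<in> L2"
    and Cauchy: "\<And>e. 0 < e \<Longrightarrow> \<exists>N. \<forall>m\<ge>N. \<forall>n\<ge>N. L2_norm (\<lambda>x. F m x - F n x) < e"
  obtains g where "g \<in> L2" "(\<lambda>n. L2_norm (\<lambda>x. g x - F n x)) \<longlonglongrightarrow> 0"
proof -
  have "\<forall>k. \<exists>N. \<forall>m\<ge>N. \<forall>n\<ge>N. L2_norm (\<lambda>x. F m x - F n x) < (1/2) ^ k"
    by (intro allI Cauchy) simp
  then obtain N where N: "\<And>k m n. m \<ge> N k \<Longrightarrow> n \<ge> N k \<Longrightarrow> L2_norm (\<lambda>x. F m x - F n x) < (1/2) ^ k"
    by metis
  \<comment> \<open>The thresholds \<open>N\<close> need not be monotone. The maximum makes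
    \<open>r k\<close> valid for every level up to k.\<close>
  define r where "r k = Max (N ` {..k})" for k
  have r: "N j \<le> r k" if "j \<le> k" for j k
    unfolding r_def using that by (intro Max_ge) auto
  note [measurable] = F[THEN L2_measurable]
  define G where "G k = F (r k)" for k
  have [measurable]: "G k \<in> borel_measurable borel" for k by (simp add: G_def)
  have G: "G k \<in> L2" for k by (simp add: G_def F)
  define D where "D k x = G (Suc k) x - G k x" for k x
  have D: "D k \<in> L2" for k unfolding D_def by (intro L2_diff G)
  have [measurable]: "D k \<in> borel_measurable borel" for k unfolding D_def by measurable
  have "(\<integral>\<^sup>+x. (\<Sum>k. ennreal (2 ^ k * (norm (D k x))\<^sup>2)) \<partial>lborel) =
      (\<Sum>k. \<integral>\<^sup>+x. ennreal (2 ^ k * (norm (D k x))\<^sup>2) \<partial>lborel)"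
    by (rule nn_integral_suminf) measurable
  also have "\<dots> \<le> (\<Sum>k. ennreal ((1/2) ^ k))"
  proof (intro suminf_le summableI)
    \<comment> \<open>The bound 2^-k squares to 4^-k, which absorbs the weight 2^k and leaves the
      summable 2^-k.\<close>
    fix k
    have "(\<integral>\<^sup>+x. ennreal (2 ^ k * (norm (D k x))\<^sup>2) \<partial>lborel) = ennreal (2 ^ k * (L2_norm (D k))\<^sup>2)"
      by (simp add: ennreal_mult nn_integral_cmult L2_nn_integral D)
    also have "\<dots> \<le> ennreal (2 ^ k * ((1/2) ^ k)\<^sup>2)"
      unfolding D_def G_def
      by (intro ennreal_leI mult_left_mono power_mono less_imp_le[OF N] r) auto
    also have "2 ^ k * ((1/2) ^ k)\<^sup>2 = (1/2 :: real) ^ k"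
      by (simp add: power2_eq_square power_one_over)
    finally show "(\<integral>\<^sup>+x. ennreal (2 ^ k * (norm (D k x))\<^sup>2) \<partial>lborel) \<le> ennreal ((1/2) ^ k)" .
  qed
  also have "\<dots> = ennreal (\<Sum>k. (1/2) ^ k)"
    by (rule suminf_ennreal2) auto
  finally have "(\<integral>\<^sup>+x. (\<Sum>k. ennreal (2 ^ k * (norm (D k x))\<^sup>2)) \<partial>lborel) \<noteq> \<infinity>"
    by (auto simp: top_unique)
  then have "AE x in lborel. (\<Sum>k. ennreal (2 ^ k * (norm (D k x))\<^sup>2)) \<noteq> \<infinity>"
    by (intro nn_integral_PInf_AE) auto
  then have conv: "AE x in lborel. (\<lambda>k. G k x) \<longlonglongrightarrow> lim (\<lambda>k. G k x)"
  proof eventually_elim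
    case (elim x)
    have "summable (\<lambda>k. 2 ^ k * (norm (D k x))\<^sup>2)"
      using elim by (intro summable_suminf_not_top) auto
    then have "summable (\<lambda>k. 2 ^ k * (norm (D k x))\<^sup>2 + (1/2) ^ k)"
      by (intro summable_add summable_geometric) auto
    then have "summable (\<lambda>k. D k x)"
    proof (rule summable_comparison_test'[where N = 0])
      fix k
      have "0 \<le> 2 ^ k * (norm (D k x) - (1/2) ^ k)\<^sup>2" by simp
      also have "\<dots> = 2 ^ k * (norm (D k x))\<^sup>2 - 2 * norm (D k x) + (1/2) ^ k"
        by (simp add: power2_diff power_one_over algebra_simps power2_eq_square)
      finally have "2 * norm (D k x) \<le> 2 ^ k * (norm (D k x))\<^sup>2 + (1/2) ^ k" by simp
      then show "norm (D k x) \<le> 2 ^ k * (norm (D k x))\<^sup>2 + (1/2) ^ k"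
        using norm_ge_zero[of "D k x"] by linarith
    qed
    then have "(\<lambda>n. (\<Sum>k<n. D k x) + G 0 x) \<longlonglongrightarrow> (\<Sum>k. D k x) + G 0 x"
      by (intro tendsto_intros summable_LIMSEQ)
    moreover have "(\<Sum>k<n. D k x) + G 0 x = G n x" for n
      unfolding D_def by (subst sum_lessThan_telescope) simp
    ultimately have "convergent (\<lambda>k. G k x)"
      by (auto simp: convergent_def)
    then show ?case by (simp add: convergent_LIMSEQ_iff)
  qed
  \<comment> \<open>Where the sequence diverges, \<open>lim\<close> has an unspecified value; this
    happens only on a null set.\<close>
  define g where "g x = lim (\<lambda>k. G k x)" for x
  have [measurable]: "g \<in> borel_measurable borel" unfolding g_def by measurable
  \<comment> \<open>With m fixed, Fatou along the subsequence \<open>G\<close> carries the Cauchy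
    bound over to the limit and yields membership in \<open>L2\<close> as well.\<close>
  have *: "(\<lambda>x. g x - F m x) \<in> L2 \<and> L2_norm (\<lambda>x. g x - F m x) \<le> (1/2) ^ j" if m: "m \<ge> N j" for j m
  proof -
    have "(\<integral>\<^sup>+x. ennreal ((norm (g x - F m x))\<^sup>2) \<partial>lborel) =
        (\<integral>\<^sup>+x. liminf (\<lambda>k. ennreal ((norm (G k x - F m x))\<^sup>2)) \<partial>lborel)"
    proof (rule nn_integral_cong_AE, use conv in eventually_elim)
      case (elim x)
      then have "(\<lambda>k. ennreal ((norm (G k x - F m x))\<^sup>2)) \<longlonglongrightarrow> ennreal ((norm (g x - F m x))\<^sup>2)"
        unfolding g_def by (intro tendsto_ennrealI tendsto_intros)
      then show ?case by (intro lim_imp_Liminf[symmetric]) simp_all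
    qed
    also have "\<dots> \<le> liminf (\<lambda>k. \<integral>\<^sup>+x. ennreal ((norm (G k x - F m x))\<^sup>2) \<partial>lborel)"
      by (rule nn_integral_liminf) measurable
    also have "\<dots> \<le> liminf (\<lambda>k. ennreal (((1/2) ^ j)\<^sup>2))"
    proof (rule Liminf_mono, rule eventually_sequentiallyI[of j])
      fix k assume "j \<le> k"
      then have "L2_norm (\<lambda>x. G k x - F m x) < (1/2) ^ j"
        unfolding G_def by (intro N m r)
      then show "(\<integral>\<^sup>+x. ennreal ((norm (G k x - F m x))\<^sup>2) \<partial>lborel) \<le> ennreal (((1/2) ^ j)\<^sup>2)"
        using G F by (subst L2_nn_integral) (auto intro!: L2_diff ennreal_leI power_mono)
    qed
    also have "\<dots> = ennreal (((1/2) ^ j)\<^sup>2)" by (simp add: Liminf_const)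
    finally show ?thesis
      by (intro conjI L2_nn_integralI L2_norm_leI) auto
  qed
  show thesis
  proof
    have "(\<lambda>x. (g x - F (N 0) x) + F (N 0) x) \<in> L2" using * by (intro L2_add F) auto
    then show "g \<in> L2" by simp
    show "(\<lambda>n. L2_norm (\<lambda>x. g x - F n x)) \<longlonglongrightarrow> 0"
    proof (rule LIMSEQ_I)
      fix e :: real assume "0 < e"
      then obtain j where "(1/2 :: real) ^ j < e" using real_arch_pow_inv[of e "1/2"] by auto
      then show "\<exists>no. \<forall>n\<ge>no. norm (L2_norm (\<lambda>x. g x - F n x) - 0) < e"
        using * by (intro exI[of _ "N j"]) (force intro: le_less_trans)
    qed
  qed
qed

section \<open>The Fourier integral on \<open>L\<^sup>1 \<inter> L\<^sup>2\<close>\<close>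

lemma nn_integral_lborel_affine:
  fixes F :: "'a::euclidean_space \<Rightarrow> ennreal"
  assumes [measurable]: "F \<in> borel_measurable borel" and c: "c \<noteq> 0"
  shows "(\<integral>\<^sup>+x. F x \<partial>lborel) = ennreal (\<bar>c\<bar> ^ DIM('a)) * (\<integral>\<^sup>+x. F (t + c *\<^sub>R x) \<partial>lborel)"
  by (subst lborel_affine[OF c, of t]) (simp add: nn_integral_density nn_integral_distr nn_integral_cmult)

lemma
  fixes F :: "'a::euclidean_space \<Rightarrow> complex"
  assumes F: "integrable lborel F" and c: "c \<noteq> 0"
  shows integrable_lborel_affine: "integrable lborel (\<lambda>x. F (t + c *\<^sub>R x))"
    and integral_lborel_affine:
      "(LINT x|lborel. F x) = of_real (\<bar>c\<bar> ^ DIM('a)) * (LINT x|lborel. F (t + c *\<^sub>R x))"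
proof -
  have [measurable]: "F \<in> borel_measurable borel" using F by auto
  let ?D = "density (distr lborel borel (\<lambda>x::'a. t + c *\<^sub>R x)) (\<lambda>_. ennreal (\<bar>c\<bar> ^ DIM('a)))"
  have L: "lborel = ?D" by (rule lborel_affine[OF c])
  have "integrable ?D F" using F L by simp
  then have "integrable lborel (\<lambda>x. \<bar>c\<bar> ^ DIM('a) *\<^sub>R F (t + c *\<^sub>R x))"
    by (simp add: integrable_density integrable_distr_eq)
  then have "integrable lborel (\<lambda>x. inverse (\<bar>c\<bar> ^ DIM('a)) *\<^sub>R (\<bar>c\<bar> ^ DIM('a) *\<^sub>R F (t + c *\<^sub>R x)))"
    by (rule integrable_scaleR_right)
  then show "integrable lborel (\<lambda>x. F (t + c *\<^sub>R x))"
    using c by simp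
  have "(LINT x|lborel. F x) = (LINT x|?D. F x)" using L by simp
  also have "\<dots> = of_real (\<bar>c\<bar> ^ DIM('a)) * (LINT x|lborel. F (t + c *\<^sub>R x))"
    by (simp add: integral_density integral_distr scaleR_conv_of_real)
  finally show "(LINT x|lborel. F x) = of_real (\<bar>c\<bar> ^ DIM('a)) * (LINT x|lborel. F (t + c *\<^sub>R x))" .
qed

section \<open>Elementary properties of the Fourier integral and the multiplication formula\<close>

lemma integrable_mult_wave:
  assumes "integrable lborel f"
  shows "integrable lborel (\<lambda>x. f x * wave (x \<bullet> \<xi>))"
  using assms by (rule Bochner_Integration.integrable_bound) (use assms in \<open>auto simp: norm_mult\<close>)

lemma borel_measurable_fourier_L1 [measurable]:
  assumes [measurable]: "f \<in> borel_measurable borel"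
  shows "fourier_L1 f \<in> borel_measurable borel"
  unfolding fourier_L1_wave[abs_def]
  by (rule lborel.borel_measurable_lebesgue_integral) simp

lemma norm_fourier_L1_le: "norm (fourier_L1 f \<xi>) \<le> (LINT x|lborel. norm (f x))"
  unfolding fourier_L1_wave
  using integral_norm_bound[of lborel "\<lambda>x. f x * wave (x \<bullet> \<xi>)"] by (simp add: norm_mult)

lemma fourier_L1_diff:
  assumes "integrable lborel f" "integrable lborel g"
  shows "fourier_L1 (\<lambda>x. f x - g x) \<xi> = fourier_L1 f \<xi> - fourier_L1 g \<xi>"
  using assms[THEN integrable_mult_wave, of \<xi>] by (simp add: fourier_L1_wave left_diff_distrib)

lemma integrable_fourier_L1_mult:
  assumes f: "integrable lborel f" and h: "integrable lborel h"
  shows "integrable lborel (\<lambda>\<xi>. fourier_L1 f \<xi> * h \<xi>)"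
proof (rule Bochner_Integration.integrable_bound)
  have [measurable]: "f \<in> borel_measurable borel" "h \<in> borel_measurable borel" using f h by auto
  show "integrable lborel (\<lambda>\<xi>. (LINT x|lborel. norm (f x)) * norm (h \<xi>))" using h by simp
  show "(\<lambda>\<xi>. fourier_L1 f \<xi> * h \<xi>) \<in> borel_measurable lborel" by simp
  show "AE \<xi> in lborel. norm (fourier_L1 f \<xi> * h \<xi>) \<le> norm ((LINT x|lborel. norm (f x)) * norm (h \<xi>))"
    using norm_fourier_L1_le[of f] by (auto simp: norm_mult intro!: mult_right_mono)
qed

text \<open>Fubini for f(x) e(x, \<xi>) h(\<xi>) with the unimodular Fourier kernel e: the product
  is absolutely integrable because f and h are.\<close>

lemma fourier_L1_mult_swap:
  fixes f h :: "'a::euclidean_space \<Rightarrow> complex"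
  assumes f: "integrable lborel f" and h: "integrable lborel h"
  shows "(LINT \<xi>|lborel. fourier_L1 f \<xi> * h \<xi>) = (LINT x|lborel. f x * fourier_L1 h x)"
proof -
  have [measurable]: "f \<in> borel_measurable borel" "h \<in> borel_measurable borel" using f h by auto
  let ?F = "\<lambda>x \<xi>. f x * wave (x \<bullet> \<xi>) * h \<xi>"
  have "integrable (lborel \<Otimes>\<^sub>M lborel) (case_prod ?F)"
  proof (rule lborel_pair.Fubini_integrable)
    show "AE x in lborel. integrable lborel (\<lambda>\<xi>. case_prod ?F (x, \<xi>))"
    proof (rule AE_I2, rule Bochner_Integration.integrable_bound)
      show "integrable lborel (\<lambda>\<xi>. f x * h \<xi>)" for x using h by simp
    qed (auto simp: norm_mult)
    show "integrable lborel (\<lambda>x. LINT \<xi>|lborel. norm (case_prod ?F (x, \<xi>)))"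
      using f by (simp add: norm_mult)
  qed simp
  then have "(LINT \<xi>|lborel. LINT x|lborel. ?F x \<xi>) = (LINT x|lborel. LINT \<xi>|lborel. ?F x \<xi>)"
    by (rule lborel_pair.Fubini_integral)
  moreover have "(LINT x|lborel. ?F x \<xi>) = fourier_L1 f \<xi> * h \<xi>" for \<xi>
    using integrable_mult_wave[OF f] by (simp add: fourier_L1_wave)
  moreover have "(LINT \<xi>|lborel. ?F x \<xi>) = f x * fourier_L1 h x" for x
    by (simp add: fourier_L1_wave inner_commute mult.assoc mult.commute[of "h _"])
  ultimately show ?thesis by (simp only:)
qed

text \<open>The reflection x -> -x undoes the conjugation of the character. This turns the squared
  modulus of a transform into a product of two transforms, to which the multiplication formula
  applies.\<close>

lemma cnj_fourier_L1:
  assumes "integrable lborel f"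
  shows "cnj (fourier_L1 f \<xi>) = fourier_L1 (\<lambda>y. cnj (f (- y))) \<xi>"
proof -
  have "cnj (fourier_L1 f \<xi>) = (LINT x|lborel. cnj (f x * wave (x \<bullet> \<xi>)))"
    by (simp only: fourier_L1_wave Bochner_Integration.integral_cnj)
  also have "\<dots> = (LINT x|lborel. cnj (f (- x)) * wave (x \<bullet> \<xi>))"
    using integral_lborel_affine[OF integrable_cnj[OF integrable_mult_wave[OF assms, of \<xi>]], of "-1" 0]
    by (simp add: cnj_wave)
  finally show ?thesis by (simp add: fourier_L1_wave)
qed

section \<open>The Gaussian-weighted energy of a transform\<close>

lemma integrable_gauss_scaled:
  assumes "t \<noteq> 0"
  shows "integrable lborel (\<lambda>x::'a::euclidean_space. complex_of_real (gauss (t *\<^sub>R x)))"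
  using integrable_lborel_affine[of "\<lambda>x::'a. complex_of_real (gauss x)" t 0] assms integrable_gauss
  by (simp add: complex_of_real_integrable_eq)

text \<open>Rescaling the fixed point \<open>gauss\<close> gives Gaussians of mass 1 that
  concentrate at the origin as t tends to 0.\<close>

lemma fourier_L1_gauss_scaled:
  fixes x :: "'a::euclidean_space"
  assumes t: "0 < t"
  shows "fourier_L1 (\<lambda>\<xi>. complex_of_real (gauss (t *\<^sub>R \<xi>))) x = of_real (gauss (x /\<^sub>R t) / t ^ DIM('a))"
proof -
  let ?F = "\<lambda>\<xi>. complex_of_real (gauss \<xi>) * wave (\<xi> \<bullet> (x /\<^sub>R t))"
  have F: "integrable lborel ?F" "integral\<^sup>L lborel ?F = of_real (gauss (x /\<^sub>R t))"
    using has_bochner_integral_gauss_wave[of "x /\<^sub>R t"] by (simp_all only: has_bochner_integral_iff)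
  have "(0 + t *\<^sub>R \<xi>) \<bullet> (x /\<^sub>R t) = \<xi> \<bullet> x" for \<xi>
    using t by simp
  then have "of_real (gauss (x /\<^sub>R t)) = of_real (t ^ DIM('a)) * fourier_L1 (\<lambda>\<xi>. complex_of_real (gauss (t *\<^sub>R \<xi>))) x"
    using integral_lborel_affine[OF F(1), of t 0] t unfolding F(2) by (simp only: fourier_L1_wave) simp
  then show ?thesis using t by (simp add: field_simps)
qed

text \<open>The squared modulus is the product of the transforms of f and of its conjugate
  reflection \<open>f'\<close>. The multiplication formula is applied twice: once to move the
  transform off f, and once to move it off \<open>f'\<close> onto a modulated Gaussian.\<close>

lemma fourier_L1_gauss_energy:
  fixes f :: "'a::euclidean_space \<Rightarrow> complex"
  assumes f: "integrable lborel f" and t: "0 < t"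
  shows "of_real (LINT \<xi>|lborel. (norm (fourier_L1 f \<xi>))\<^sup>2 * gauss (t *\<^sub>R \<xi>)) =
    (LINT x|lborel. f x * (LINT y|lborel. cnj (f (x - t *\<^sub>R y)) * of_real (gauss y)))"
proof -
  have [measurable]: "f \<in> borel_measurable borel" using f by auto
  define f' where "f' y = cnj (f (- y))" for y
  have f': "integrable lborel f'"
    using integrable_lborel_affine[OF f, of "-1" 0] by (simp add: f'_def[abs_def])
  have F': "cnj (fourier_L1 f \<xi>) = fourier_L1 f' \<xi>" for \<xi>
    using cnj_fourier_L1[OF f] by (simp add: f'_def[abs_def])
  let ?G = "\<lambda>\<xi>. complex_of_real (gauss (t *\<^sub>R \<xi>))"
  have G: "integrable lborel ?G" using t by (intro integrable_gauss_scaled) simp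
  have h: "integrable lborel (\<lambda>\<xi>. fourier_L1 f' \<xi> * ?G \<xi>)"
    by (rule integrable_fourier_L1_mult[OF f' G])
  have inner: "fourier_L1 (\<lambda>\<xi>. fourier_L1 f' \<xi> * ?G \<xi>) x =
      (LINT y|lborel. cnj (f (x - t *\<^sub>R y)) * of_real (gauss y))" for x
  proof -
    have Gw: "integrable lborel (\<lambda>\<xi>. ?G \<xi> * wave (\<xi> \<bullet> x))"
      by (rule integrable_mult_wave[OF G])
    \<comment> \<open>Modulation by a character becomes translation of the transform.\<close>
    have "fourier_L1 (\<lambda>\<xi>. ?G \<xi> * wave (\<xi> \<bullet> x)) y = fourier_L1 ?G (x + y)" for y
      by (simp add: fourier_L1_wave inner_add_right wave_add mult.assoc)
    then have *: "fourier_L1 (\<lambda>\<xi>. ?G \<xi> * wave (\<xi> \<bullet> x)) y = of_real (gauss ((x + y) /\<^sub>R t) / t ^ DIM('a))" for y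
      using fourier_L1_gauss_scaled[OF t] by simp
    have "fourier_L1 (\<lambda>\<xi>. fourier_L1 f' \<xi> * ?G \<xi>) x =
        (LINT \<xi>|lborel. fourier_L1 f' \<xi> * (?G \<xi> * wave (\<xi> \<bullet> x)))"
      by (simp add: fourier_L1_wave[of _ x] mult.assoc)
    also have "\<dots> = (LINT y|lborel. f' y * of_real (gauss ((x + y) /\<^sub>R t) / t ^ DIM('a)))"
      by (simp only: fourier_L1_mult_swap[OF f' Gw] *)
    \<comment> \<open>Substituting -x + t y for y centres the Gaussian; the Jacobian t^d cancels its
      normalizing factor.\<close>
    also have "\<dots> = of_real (t ^ DIM('a)) * (LINT y|lborel. f' (- x + t *\<^sub>R y) *
        of_real (gauss ((x + (- x + t *\<^sub>R y)) /\<^sub>R t) / t ^ DIM('a)))"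
    proof (subst integral_lborel_affine[of _ t "- x"])
      \<comment> \<open>Integrability follows once the Gaussian factor is read as the Fourier
        integral of an integrable function, hence bounded.\<close>
      have "(\<lambda>y. f' y * of_real (gauss ((x + y) /\<^sub>R t) / t ^ DIM('a))) =
         (\<lambda>y. fourier_L1 (\<lambda>\<xi>. ?G \<xi> * wave (\<xi> \<bullet> x)) y * f' y)"
        unfolding * by (rule ext, rule mult.commute)
      then show "integrable lborel (\<lambda>y. f' y * of_real (gauss ((x + y) /\<^sub>R t) / t ^ DIM('a)))"
        using integrable_fourier_L1_mult[OF Gw f'] by simp
    qed (use t in auto)
    also have "\<dots> = (LINT y|lborel. cnj (f (x - t *\<^sub>R y)) * of_real (gauss y))"
      using t by (simp add: f'_def)
    finally show ?thesis .
  qed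
  have "of_real (LINT \<xi>|lborel. (norm (fourier_L1 f \<xi>))\<^sup>2 * gauss (t *\<^sub>R \<xi>)) =
      (LINT \<xi>|lborel. fourier_L1 f \<xi> * (fourier_L1 f' \<xi> * ?G \<xi>))"
    by (subst integral_complex_of_real[symmetric], rule Bochner_Integration.integral_cong)
      (simp_all only: of_real_mult complex_norm_square F' mult.assoc)
  also have "\<dots> = (LINT x|lborel. f x * fourier_L1 (\<lambda>\<xi>. fourier_L1 f' \<xi> * ?G \<xi>) x)"
    by (rule fourier_L1_mult_swap[OF f h])
  finally show ?thesis by (simp only: inner)
qed

section \<open>The contraction estimate\<close>

lemma L2_affine:
  fixes f :: "'a::euclidean_space \<Rightarrow> complex"
  assumes f: "f \<in> L2" and c: "\<bar>c\<bar> = 1"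
  shows "(\<lambda>x. f (t + c *\<^sub>R x)) \<in> L2" and "L2_norm (\<lambda>x. f (t + c *\<^sub>R x)) = L2_norm f"
proof -
  have [measurable]: "f \<in> borel_measurable borel" using f by (rule L2_measurable)
  have *: "(\<integral>\<^sup>+x. ennreal ((norm (f (t + c *\<^sub>R x)))\<^sup>2) \<partial>lborel) = ennreal ((L2_norm f)\<^sup>2)"
    using nn_integral_lborel_affine[of "\<lambda>x. ennreal ((norm (f x))\<^sup>2)" c t] c L2_nn_integral[OF f] by auto
  show L: "(\<lambda>x. f (t + c *\<^sub>R x)) \<in> L2"
    using * by (intro L2_nn_integralI[where c = "L2_norm f"]) auto
  have "(L2_norm (\<lambda>x. f (t + c *\<^sub>R x)))\<^sup>2 = (L2_norm f)\<^sup>2"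
    using * L2_nn_integral[OF L] by simp
  then show "L2_norm (\<lambda>x. f (t + c *\<^sub>R x)) = L2_norm f"
    by simp
qed

lemma L2_norm_dominated_convergence:
  assumes D [measurable]: "\<And>n. D n \<in> borel_measurable borel" and w: "w \<in> L2"
    and le: "\<And>n x. norm (D n x) \<le> norm (w x)"
    and lim: "AE x in lborel. (\<lambda>n. D n x) \<longlonglongrightarrow> 0"
  shows "(\<lambda>n. L2_norm (D n)) \<longlonglongrightarrow> 0"
proof -
  have "(\<lambda>n. LINT x|lborel. (norm (D n x))\<^sup>2) \<longlonglongrightarrow> (LINT x::'a|lborel. 0)"
  proof (rule integral_dominated_convergence[where w = "\<lambda>x. (norm (w x))\<^sup>2"])
    show "AE x in lborel. (\<lambda>n. (norm (D n x))\<^sup>2) \<longlonglongrightarrow> 0"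
      using lim by eventually_elim (auto intro!: tendsto_eq_intros)
    show "AE x in lborel. norm ((norm (D n x))\<^sup>2) \<le> (norm (w x))\<^sup>2" for n
      using le by (auto intro!: power_mono)
  qed (use w L2_square_integrable in auto)
  then have "(\<lambda>n. sqrt (LINT x|lborel. (norm (D n x))\<^sup>2)) \<longlonglongrightarrow> sqrt 0"
    by (intro tendsto_real_sqrt) simp
  then show ?thesis by (simp add: L2_norm_def[abs_def])
qed

text \<open>No integrability is assumed: otherwise the Bochner integral has the default value 0 and
  the bound is trivial.\<close>

lemma norm_integral_le_nn_integral:
  fixes f :: "'a \<Rightarrow> 'b::{banach, second_countable_topology}"
  shows "ennreal (norm (integral\<^sup>L M f)) \<le> (\<integral>\<^sup>+x. ennreal (norm (f x)) \<partial>M)"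
  by (cases "integrable M f") (auto simp: integral_norm_bound_ennreal not_integrable_integral_eq)

text \<open>By Tonelli the energy is bounded by the Gaussian average over y of the correlation of
  |f| with its translate by t y. Cauchy-Schwarz and translation invariance bound each correlation by
  the squared norm of f, and the Gaussian has mass 1.\<close>

lemma gauss_energy_le:
  fixes f :: "'a::euclidean_space \<Rightarrow> complex"
  assumes f: "f \<in> L2" and int: "integrable lborel f" and t: "0 < t"
  shows "(\<integral>\<^sup>+\<xi>. ennreal ((norm (fourier_L1 f \<xi>))\<^sup>2 * gauss (t *\<^sub>R \<xi>)) \<partial>lborel) \<le> ennreal ((L2_norm f)\<^sup>2)"
proof -
  have [measurable]: "f \<in> borel_measurable borel" using f by (rule L2_measurable)
  let ?I = "\<lambda>x. LINT y|lborel. cnj (f (x - t *\<^sub>R y)) * complex_of_real (gauss y)"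
  have inner: "(\<integral>\<^sup>+x. ennreal (norm (f x) * norm (f (x - t *\<^sub>R y)) * gauss y) \<partial>lborel)
      \<le> ennreal ((L2_norm f)\<^sup>2) * ennreal (gauss y)" for y
  proof -
    let ?g = "\<lambda>x. f (- (t *\<^sub>R y) + 1 *\<^sub>R x)"
    have g: "?g \<in> L2" "L2_norm ?g = L2_norm f" using L2_affine[OF f, of 1 "- (t *\<^sub>R y)"] by simp_all
    have "(\<integral>\<^sup>+x. ennreal (norm (f x * ?g x)) \<partial>lborel) \<le> ennreal (L2_norm f * L2_norm ?g)"
      using L2_Cauchy_Schwarz(1)[OF f g(1)] L2_mult_integrable[OF f g(1)]
      by (subst nn_integral_eq_integral) (auto intro: ennreal_leI)
    then have "(\<integral>\<^sup>+x. ennreal (norm (f x * ?g x)) \<partial>lborel) * ennreal (gauss y)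
        \<le> ennreal ((L2_norm f)\<^sup>2) * ennreal (gauss y)"
      unfolding g by (intro mult_right_mono) (auto simp: power2_eq_square)
    then show ?thesis
      by (simp add: norm_mult ennreal_mult nn_integral_multc[symmetric] del: add_uminus_conv_diff)
  qed
  \<comment> \<open>The transform is bounded by the L1 norm of f, so the Gaussian weight makes the
    energy finite.\<close>
  have "integrable lborel (\<lambda>\<xi>. complex_of_real ((norm (fourier_L1 f \<xi>))\<^sup>2 * gauss (t *\<^sub>R \<xi>)))"
  proof (rule Bochner_Integration.integrable_bound)
    let ?K = "LINT x|lborel. norm (f x)"
    show "integrable lborel (\<lambda>\<xi>::'a. of_real (?K\<^sup>2) * complex_of_real (gauss (t *\<^sub>R \<xi>)))"
      using integrable_gauss_scaled[of t] t by (intro integrable_mult_right) simp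
    show "AE \<xi> in lborel. norm (complex_of_real ((norm (fourier_L1 f \<xi>))\<^sup>2 * gauss (t *\<^sub>R \<xi>)))
        \<le> norm (of_real (?K\<^sup>2) * complex_of_real (gauss (t *\<^sub>R \<xi>)))"
      using norm_fourier_L1_le[of f]
      by (auto simp: norm_mult norm_power intro!: mult_right_mono power_mono)
  qed simp
  then have "integrable lborel (\<lambda>\<xi>. (norm (fourier_L1 f \<xi>))\<^sup>2 * gauss (t *\<^sub>R \<xi>))"
    unfolding complex_of_real_integrable_eq .
  then have "(\<integral>\<^sup>+\<xi>. ennreal ((norm (fourier_L1 f \<xi>))\<^sup>2 * gauss (t *\<^sub>R \<xi>)) \<partial>lborel) =
      ennreal (LINT \<xi>|lborel. (norm (fourier_L1 f \<xi>))\<^sup>2 * gauss (t *\<^sub>R \<xi>))"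
    by (intro nn_integral_eq_integral) auto
  also have "\<dots> = ennreal (norm (LINT x|lborel. f x * ?I x))"
    unfolding fourier_L1_gauss_energy[OF int t, symmetric] norm_of_real
    by (subst abs_of_nonneg) (auto intro!: Bochner_Integration.integral_nonneg)
  also have "\<dots> \<le> (\<integral>\<^sup>+x. ennreal (norm (f x * ?I x)) \<partial>lborel)"
    by (rule norm_integral_le_nn_integral)
  also have "\<dots> \<le> (\<integral>\<^sup>+x. \<integral>\<^sup>+y. ennreal (norm (f x) * norm (f (x - t *\<^sub>R y)) * gauss y) \<partial>lborel \<partial>lborel)"
  proof (rule nn_integral_mono)
    fix x
    have "ennreal (norm (f x * ?I x)) \<le> ennreal (norm (f x)) *
        (\<integral>\<^sup>+y. ennreal (norm (cnj (f (x - t *\<^sub>R y)) * complex_of_real (gauss y))) \<partial>lborel)"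
      unfolding norm_mult[of "f x"] ennreal_mult'[OF norm_ge_zero]
      by (intro mult_left_mono norm_integral_le_nn_integral) simp
    then show "ennreal (norm (f x * ?I x)) \<le>
        (\<integral>\<^sup>+y. ennreal (norm (f x) * norm (f (x - t *\<^sub>R y)) * gauss y) \<partial>lborel)"
      by (simp add: norm_mult ennreal_mult' nn_integral_cmult[symmetric] mult.assoc)
  qed
  also have "\<dots> = (\<integral>\<^sup>+y. \<integral>\<^sup>+x. ennreal (norm (f x) * norm (f (x - t *\<^sub>R y)) * gauss y) \<partial>lborel \<partial>lborel)"
    by (rule lborel_pair.Fubini'[symmetric]) measurable
  also have "\<dots> \<le> (\<integral>\<^sup>+y. ennreal ((L2_norm f)\<^sup>2) * ennreal (gauss (y::'a)) \<partial>lborel)"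
    by (rule nn_integral_mono) (rule inner)
  also have "\<dots> = ennreal ((L2_norm f)\<^sup>2)"
    using nn_integral_eq_integral[OF integrable_gauss[where 'a = 'a]] integral_gauss[where 'a = 'a]
    by (simp add: nn_integral_cmult)
  finally show ?thesis .
qed

text \<open>The weights tend to 1 as t = 1/(n+1) tends to 0, so Fatou turns the uniform bound on
  weighted energies into a bound on the full energy.\<close>

lemma fourier_L1_contraction:
  fixes f :: "'a::euclidean_space \<Rightarrow> complex"
  assumes f: "f \<in> L2" and int: "integrable lborel f"
  shows "fourier_L1 f \<in> L2" and "L2_norm (fourier_L1 f) \<le> L2_norm f"
proof -
  have [measurable]: "f \<in> borel_measurable borel" using f by (rule L2_measurable)
  let ?u = "\<lambda>n \<xi>. ennreal ((norm (fourier_L1 f \<xi>))\<^sup>2 * gauss ((1 / real (Suc n)) *\<^sub>R \<xi>))"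
  have "(\<integral>\<^sup>+\<xi>. ennreal ((norm (fourier_L1 f \<xi>))\<^sup>2) \<partial>lborel) = (\<integral>\<^sup>+\<xi>. liminf (\<lambda>n. ?u n \<xi>) \<partial>lborel)"
  proof (rule nn_integral_cong)
    fix \<xi> :: 'a
    have "(\<lambda>n. gauss ((1 / real (Suc n)) *\<^sub>R \<xi>)) \<longlonglongrightarrow> gauss (0 *\<^sub>R \<xi>)"
      unfolding gauss_def by (intro tendsto_intros LIMSEQ_Suc[OF lim_1_over_n])
    then have "(\<lambda>n. ?u n \<xi>) \<longlonglongrightarrow> ennreal ((norm (fourier_L1 f \<xi>))\<^sup>2 * gauss (0 *\<^sub>R \<xi>))"
      by (intro tendsto_ennrealI tendsto_intros)
    then show "ennreal ((norm (fourier_L1 f \<xi>))\<^sup>2) = liminf (\<lambda>n. ?u n \<xi>)"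
      by (intro lim_imp_Liminf[symmetric]) (simp_all add: gauss_def)
  qed
  also have "\<dots> \<le> liminf (\<lambda>n. integral\<^sup>N lborel (?u n))"
    by (rule nn_integral_liminf) measurable
  also have "\<dots> \<le> liminf (\<lambda>n. ennreal ((L2_norm f)\<^sup>2))"
    by (intro Liminf_mono always_eventually allI gauss_energy_le f int) simp
  also have "\<dots> = ennreal ((L2_norm f)\<^sup>2)" by (simp add: Liminf_const)
  finally have *: "(\<integral>\<^sup>+\<xi>. ennreal ((norm (fourier_L1 f \<xi>))\<^sup>2) \<partial>lborel) \<le> ennreal ((L2_norm f)\<^sup>2)" .
  show "fourier_L1 f \<in> L2" by (rule L2_nn_integralI[OF _ _ *]) simp_all
  show "L2_norm (fourier_L1 f) \<le> L2_norm f" by (rule L2_norm_leI[OF _ _ *]) simp_all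
qed

section \<open>Isometry on bounded continuous functions, their density, and Plancherel for the
  Fourier integral\<close>

lemma L2_of_bounded_integrable:
  assumes g: "integrable lborel g" and M: "\<And>x. norm (g x) \<le> M"
  shows "g \<in> L2"
proof -
  have "integrable lborel (\<lambda>x. (norm (g x))\<^sup>2)"
  proof (rule Bochner_Integration.integrable_bound)
    show "integrable lborel (\<lambda>x. M * norm (g x))" using g by simp
    show "AE x in lborel. norm ((norm (g x))\<^sup>2) \<le> norm (M * norm (g x))"
      using M order_trans[OF norm_ge_zero M]
      by (auto simp: power2_eq_square norm_mult intro!: mult_right_mono)
  qed (use g in auto)
  then show ?thesis using g by (simp add: L2_def)
qed

text \<open>Both sides of \<open>fourier_L1_gauss_energy\<close> are passed to the limit t -> 0.
  Continuity makes the Gaussian averages of g converge at every point, and boundedness supplies the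
  dominating functions.\<close>

lemma fourier_L1_isometry_continuous:
  fixes g :: "'a::euclidean_space \<Rightarrow> complex"
  assumes g: "integrable lborel g" and M: "\<And>x. norm (g x) \<le> M" and cont: "continuous_on UNIV g"
  shows "L2_norm (fourier_L1 g) = L2_norm g"
proof -
  have [measurable]: "g \<in> borel_measurable borel" using g by auto
  have gL2: "g \<in> L2" by (rule L2_of_bounded_integrable[OF g M])
  have FL2: "fourier_L1 g \<in> L2" by (rule fourier_L1_contraction[OF gL2 g])
  have "0 \<le> M" using order_trans[OF norm_ge_zero M] .
  define t where "t n = 1 / real (Suc n)" for n
  have t: "t n > 0" for n by (simp add: t_def)
  have t0: "t \<longlonglongrightarrow> 0" unfolding t_def by (intro LIMSEQ_Suc[OF lim_1_over_n])
  let ?E = "\<lambda>n. LINT \<xi>|lborel. (norm (fourier_L1 g \<xi>))\<^sup>2 * gauss (t n *\<^sub>R \<xi>)"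
  let ?I = "\<lambda>n x. LINT y|lborel. cnj (g (x - t n *\<^sub>R y)) * complex_of_real (gauss y)"
  have cg: "integrable lborel (\<lambda>y::'a. complex_of_real (gauss y))"
    using integrable_gauss by (simp add: complex_of_real_integrable_eq)
  \<comment> \<open>The unweighted energy, finite by the contraction estimate, dominates.\<close>
  have "?E \<longlonglongrightarrow> (LINT \<xi>|lborel. (norm (fourier_L1 g \<xi>))\<^sup>2)"
  proof (rule integral_dominated_convergence[where w = "\<lambda>\<xi>. (norm (fourier_L1 g \<xi>))\<^sup>2"])
    have "(\<lambda>n. (norm (fourier_L1 g \<xi>))\<^sup>2 * gauss (t n *\<^sub>R \<xi>)) \<longlonglongrightarrow>
        (norm (fourier_L1 g \<xi>))\<^sup>2 * gauss (0 *\<^sub>R \<xi>)" for \<xi>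
      unfolding gauss_def by (intro tendsto_intros t0)
    then show "AE \<xi> in lborel. (\<lambda>n. (norm (fourier_L1 g \<xi>))\<^sup>2 * gauss (t n *\<^sub>R \<xi>)) \<longlonglongrightarrow>
        (norm (fourier_L1 g \<xi>))\<^sup>2" by (simp add: gauss_def)
    show "AE \<xi> in lborel. norm ((norm (fourier_L1 g \<xi>))\<^sup>2 * gauss (t n *\<^sub>R \<xi>)) \<le> (norm (fourier_L1 g \<xi>))\<^sup>2" for n
      by (auto simp: norm_mult intro!: mult_left_le gauss_le_1)
  qed (use L2_square_integrable[OF FL2] in auto)
  then have lim1: "(\<lambda>n. complex_of_real (?E n)) \<longlonglongrightarrow> of_real ((L2_norm (fourier_L1 g))\<^sup>2)"
    by (simp add: L2_norm_square tendsto_of_real_iff)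
  have lim_inner: "(\<lambda>n. ?I n x) \<longlonglongrightarrow> cnj (g x)" for x
  proof -
    have "(\<lambda>n. ?I n x) \<longlonglongrightarrow> (LINT y|lborel. cnj (g x) * complex_of_real (gauss (y::'a)))"
    proof (rule integral_dominated_convergence[where w = "\<lambda>y::'a. M * gauss y"])
      have "isCont g x" using cont by (simp add: continuous_on_eq_continuous_at)
      moreover have "(\<lambda>n. x - t n *\<^sub>R y) \<longlonglongrightarrow> x - 0 *\<^sub>R y" for y
        by (intro tendsto_intros t0)
      ultimately have "(\<lambda>n. g (x - t n *\<^sub>R y)) \<longlonglongrightarrow> g x" for y
        by (auto intro: isCont_tendsto_compose)
      then show "AE y in lborel. (\<lambda>n. cnj (g (x - t n *\<^sub>R y)) * complex_of_real (gauss y))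
          \<longlonglongrightarrow> cnj (g x) * complex_of_real (gauss y)"
        by (intro AE_I2 tendsto_intros)
      show "AE y in lborel. norm (cnj (g (x - t n *\<^sub>R y)) * complex_of_real (gauss y)) \<le> M * gauss y" for n
        using M by (auto simp: norm_mult intro!: mult_right_mono)
    qed (use integrable_gauss in auto)
    then show ?thesis by (simp add: integral_gauss)
  qed
  \<comment> \<open>This bound is uniform in n and x, so M |g| dominates the outer
    integrand.\<close>
  have norm_inner: "norm (?I n x) \<le> M" for n x
  proof -
    have "norm (?I n x) \<le> (LINT y|lborel. M * gauss (y::'a))"
    proof (rule Bochner_Integration.integral_norm_bound_integral)
      show "integrable lborel (\<lambda>y. cnj (g (x - t n *\<^sub>R y)) * complex_of_real (gauss y))"
        by (rule Bochner_Integration.integrable_bound[of _ "\<lambda>y::'a. M * gauss y"])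
          (use integrable_gauss M \<open>0 \<le> M\<close> in \<open>auto simp: norm_mult abs_mult intro!: mult_right_mono\<close>)
    qed (use integrable_gauss M in \<open>auto simp: norm_mult intro!: mult_right_mono\<close>)
    then show ?thesis by (simp add: integral_gauss)
  qed
  have "(\<lambda>n. LINT x|lborel. g x * ?I n x) \<longlonglongrightarrow> (LINT x|lborel. g x * cnj (g x))"
  proof (rule integral_dominated_convergence[where w = "\<lambda>x. norm (g x) * M"])
    show "AE x in lborel. (\<lambda>n. g x * ?I n x) \<longlonglongrightarrow> g x * cnj (g x)"
      by (intro AE_I2 tendsto_intros lim_inner)
    show "AE x in lborel. norm (g x * ?I n x) \<le> norm (g x) * M" for n
      unfolding norm_mult by (intro AE_I2 mult_left_mono norm_inner) simp
    have "?I n \<in> borel_measurable lborel" for n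
      by (rule lborel.borel_measurable_lebesgue_integral) simp
    then show "(\<lambda>x. g x * ?I n x) \<in> borel_measurable lborel" for n
      by measurable
  qed (use g in auto)
  moreover have "(LINT x|lborel. g x * cnj (g x)) = of_real ((L2_norm g)\<^sup>2)"
    by (rule integral_mult_cnj)
  ultimately have "complex_of_real ((L2_norm (fourier_L1 g))\<^sup>2) = of_real ((L2_norm g)\<^sup>2)"
    using lim1 fourier_L1_gauss_energy[OF g t] by (auto intro: LIMSEQ_unique)
  then show ?thesis
    by (simp only: of_real_eq_iff) (simp add: power2_eq_iff_nonneg)
qed

text \<open>After truncation f is bounded with bounded support. It is then an almost everywhere
  limit of continuous functions, and clipping these in size and damping them by an integrable factor
  allows dominated convergence in L2.\<close>

lemma L2_dense_continuous:
  fixes f :: "'a::euclidean_space \<Rightarrow> complex"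
  assumes f: "f \<in> L2" and e: "0 < e"
  obtains g M where "integrable lborel g" "continuous_on UNIV g" "\<And>x. norm (g x) \<le> M"
    "L2_norm (\<lambda>x. f x - g x) < e"
proof -
  have [measurable]: "f \<in> borel_measurable borel" using f by (rule L2_measurable)
  define h where "h n x = (if norm (f x) \<le> real n \<and> norm x \<le> real n then f x else 0)" for n x
  have [measurable]: "h n \<in> borel_measurable borel" for n unfolding h_def by measurable
  have "(\<lambda>n. L2_norm (\<lambda>x. f x - h n x)) \<longlonglongrightarrow> 0"
  proof (rule L2_norm_dominated_convergence[OF _ f])
    have "eventually (\<lambda>n. f x - h n x = 0) sequentially" for x
    proof -
      obtain N where "max (norm (f x)) (norm x) \<le> real N" using real_arch_simple by blast
      then show ?thesis by (intro eventually_sequentiallyI[of N]) (auto simp: h_def)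
    qed
    then show "AE x in lborel. (\<lambda>n. f x - h n x) \<longlonglongrightarrow> 0"
      by (intro AE_I2 tendsto_eventually)
  qed (auto simp: h_def)
  then have "eventually (\<lambda>n. L2_norm (\<lambda>x. f x - h n x) < e / 2) sequentially"
    using e by (intro order_tendstoD(2)) auto
  then obtain n where n: "L2_norm (\<lambda>x. f x - h n x) < e / 2"
    using eventually_happens'[OF sequentially_bot] by blast
  \<comment> \<open>The added 1 keeps m positive even for n = 0, so that dividing by a maximum with
    m is safe.\<close>
  define m where "m = real n + 1"
  have m: "0 < m" "\<And>x. norm (h n x) \<le> m" "\<And>x. h n x \<noteq> 0 \<Longrightarrow> norm x \<le> m"
    by (auto simp: m_def h_def split: if_splits)
  have hL2: "h n \<in> L2"
    by (rule L2_AE_mono[OF f]) (auto simp: h_def)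
  \<comment> \<open>A continuous integrable cutoff equal to 1 on the ball of radius m, which
    contains the support of \<open>h n\<close>: the factor exp(pi m^2) lifts the Gaussian to at
    least 1 there.\<close>
  define \<phi> :: "'a \<Rightarrow> real" where "\<phi> x = min 1 (gauss x * exp (pi * m\<^sup>2))" for x
  have \<phi>: "0 \<le> \<phi> x" "\<phi> x \<le> 1" for x by (auto simp: \<phi>_def)
  have \<phi>1: "\<phi> x = 1" if "norm x \<le> m" for x
  proof -
    have "pi * (norm x)\<^sup>2 \<le> pi * m\<^sup>2"
      using that by (intro mult_left_mono power_mono) auto
    moreover have "gauss x * exp (pi * m\<^sup>2) = exp (pi * m\<^sup>2 - pi * (norm x)\<^sup>2)"
      by (simp only: gauss_def exp_add[symmetric]) simp
    ultimately show ?thesis by (simp add: \<phi>_def)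
  qed
  have [measurable]: "\<phi> \<in> borel_measurable borel" unfolding \<phi>_def by measurable
  have \<phi>_int: "integrable lborel (\<lambda>x. complex_of_real (c * \<phi> x))" for c
  proof (rule Bochner_Integration.integrable_bound)
    show "integrable lborel (\<lambda>x::'a. \<bar>c\<bar> * (gauss x * exp (pi * m\<^sup>2)))" using integrable_gauss by auto
    show "AE x in lborel. norm (complex_of_real (c * \<phi> x)) \<le> norm (\<bar>c\<bar> * (gauss x * exp (pi * m\<^sup>2)))"
    proof (rule AE_I2)
      fix x
      have "norm (complex_of_real (c * \<phi> x)) = \<bar>c\<bar> * \<phi> x"
        using \<phi>(1)[of x] by (simp only: norm_of_real abs_mult abs_of_nonneg)
      also have "\<dots> \<le> \<bar>c\<bar> * (gauss x * exp (pi * m\<^sup>2))"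
        by (intro mult_left_mono) (simp_all add: \<phi>_def)
      also have "\<dots> \<le> norm (\<bar>c\<bar> * (gauss x * exp (pi * m\<^sup>2)))"
        by simp
      finally show "norm (complex_of_real (c * \<phi> x)) \<le> norm (\<bar>c\<bar> * (gauss x * exp (pi * m\<^sup>2)))" .
    qed
  qed simp
  have \<phi>_L2: "(\<lambda>x. complex_of_real (c * \<phi> x)) \<in> L2" for c
  proof (rule L2_of_bounded_integrable[OF \<phi>_int])
    show "norm (complex_of_real (c * \<phi> x)) \<le> \<bar>c\<bar>" for x
      unfolding norm_of_real abs_mult abs_of_nonneg[OF \<phi>(1)]
      by (rule mult_left_le[OF \<phi>(2)]) simp
  qed
  \<comment> \<open>By its definition \<open>measurable_on\<close> provides continuous functions
    converging pointwise off a negligible set.\<close>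
  have "h n measurable_on UNIV"
    by (intro lebesgue_measurable_imp_measurable_on) (auto intro: measurable_completion)
  then obtain N G where N: "negligible N" and G: "\<And>k. continuous_on UNIV (G k)"
    and lim: "\<And>x. x \<notin> N \<Longrightarrow> (\<lambda>k. G k x) \<longlonglongrightarrow> h n x"
    unfolding measurable_on_def by auto
  \<comment> \<open>Radial clipping to modulus at most m. It is continuous and fixes the values of
    \<open>h n\<close>, so the pointwise limit is unchanged.\<close>
  define c where "c k x = of_real (m / max m (norm (G k x))) * G k x" for k x
  have max_nz: "max m (norm (z::complex)) \<noteq> 0" for z
    using m(1) by linarith
  have norm_c: "norm (c k x) \<le> m" for k x
  proof -
    have "norm (c k x) = m / max m (norm (G k x)) * norm (G k x)"
      unfolding c_def norm_mult norm_of_real using m(1) by (subst abs_of_nonneg) auto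
    also have "\<dots> \<le> m / max m (norm (G k x)) * max m (norm (G k x))"
      using m(1) by (intro mult_left_mono) auto
    also have "\<dots> = m" using max_nz by simp
    finally show ?thesis .
  qed
  have cont_c: "continuous_on UNIV (c k)" for k
    unfolding c_def by (intro continuous_intros G ballI max_nz)
  have lim_c: "(\<lambda>k. c k x) \<longlonglongrightarrow> h n x" if "x \<notin> N" for x
  proof -
    have "(\<lambda>k. c k x) \<longlonglongrightarrow> of_real (m / max m (norm (h n x))) * h n x"
      unfolding c_def by (intro tendsto_intros lim that max_nz)
    then show ?thesis using m(1) m(2)[of x] by (simp add: max_absorb1)
  qed
  define g where "g k x = of_real (\<phi> x) * c k x" for k x
  have [measurable]: "c k \<in> borel_measurable borel" for k
    by (rule borel_measurable_continuous_onI[OF cont_c])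
  have [measurable]: "g k \<in> borel_measurable borel" for k unfolding g_def by measurable
  have norm_g: "norm (g k x) \<le> m * \<phi> x" for k x
    using mult_left_mono[OF norm_c[of k x] \<phi>(1)[of x]] \<phi>(1)[of x]
    by (simp add: g_def norm_mult mult.commute)
  have "(\<lambda>k. L2_norm (\<lambda>x. h n x - g k x)) \<longlonglongrightarrow> 0"
  proof (rule L2_norm_dominated_convergence[OF _ \<phi>_L2[of "2 * m"]])
    show "norm (h n x - g k x) \<le> norm (complex_of_real (2 * m * \<phi> x))" for k x
    proof -
      have "norm (h n x) \<le> m * \<phi> x"
      proof (cases "h n x = 0")
        case True
        then show ?thesis using m(1) \<phi>(1)[of x] by simp
      next
        case False
        then show ?thesis using m(2)[of x] \<phi>1[OF m(3)] by simp
      qed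
      then have "norm (h n x - g k x) \<le> 2 * m * \<phi> x"
        using norm_triangle_ineq4[of "h n x" "g k x"] norm_g[of k x] by simp
      then show ?thesis
        using abs_ge_self[of "2 * m * \<phi> x"] by (simp only: norm_of_real)
    qed
    have "AE x in lebesgue. x \<notin> N"
      using N by (intro AE_not_in) (simp add: negligible_iff_null_sets)
    then have "AE x in lborel. x \<notin> N" by (simp add: AE_completion_iff)
    then show "AE x in lborel. (\<lambda>k. h n x - g k x) \<longlonglongrightarrow> 0"
    proof eventually_elim
      case (elim x)
      have "(\<lambda>k. h n x - g k x) \<longlonglongrightarrow> h n x - of_real (\<phi> x) * h n x"
        unfolding g_def by (intro tendsto_intros lim_c elim)
      moreover have "h n x - of_real (\<phi> x) * h n x = 0"
        using \<phi>1[OF m(3)] by (cases "h n x = 0") simp_all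
      ultimately show ?case by simp
    qed
  qed measurable
  then have "eventually (\<lambda>k. L2_norm (\<lambda>x. h n x - g k x) < e / 2) sequentially"
    using e by (intro order_tendstoD(2)) auto
  then obtain k where k: "L2_norm (\<lambda>x. h n x - g k x) < e / 2"
    using eventually_happens'[OF sequentially_bot] by blast
  have g_int: "integrable lborel (g k)"
  proof (rule Bochner_Integration.integrable_bound[OF \<phi>_int[of m]])
    show "AE x in lborel. norm (g k x) \<le> norm (complex_of_real (m * \<phi> x))"
      unfolding norm_of_real by (intro AE_I2 order_trans[OF norm_g abs_ge_self])
  qed simp
  have g_le: "norm (g k x) \<le> m" for x
    using norm_g[of k x] mult_left_le[of "\<phi> x" m] \<phi>[of x] m(1) by linarith
  show thesis
  proof
    show "integrable lborel (g k)" by (rule g_int)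
    show "continuous_on UNIV (g k)"
      unfolding g_def \<phi>_def by (intro continuous_intros cont_c)
    show "norm (g k x) \<le> m" for x by (rule g_le)
    show "L2_norm (\<lambda>x. f x - g k x) < e"
      using L2_norm_triangle_diff[OF f hL2 L2_of_bounded_integrable[OF g_int g_le]] n k by simp
  qed
qed

text \<open>For the reverse inequality, f is replaced by a nearby g for which equality holds. By the
  contraction, each of the two norms moves by less than e/2.\<close>

lemma fourier_L1_Plancherel:
  fixes f :: "'a::euclidean_space \<Rightarrow> complex"
  assumes f: "f \<in> L2" and int: "integrable lborel f"
  shows "L2_norm (fourier_L1 f) = L2_norm f"
proof (rule antisym)
  show "L2_norm (fourier_L1 f) \<le> L2_norm f" by (rule fourier_L1_contraction[OF f int])
  show "L2_norm f \<le> L2_norm (fourier_L1 f)"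
  proof (rule field_le_epsilon)
    fix e :: real assume "0 < e"
    then have "0 < e / 2" by simp
    from L2_dense_continuous[OF f this] obtain g M where g: "integrable lborel g" "continuous_on UNIV g"
      and M: "\<And>x. norm (g x) \<le> M" and fg: "L2_norm (\<lambda>x. f x - g x) < e / 2" by blast
    have gL2: "g \<in> L2" by (rule L2_of_bounded_integrable[OF g(1) M])
    have "L2_norm (\<lambda>\<xi>. fourier_L1 f \<xi> - fourier_L1 g \<xi>) \<le> L2_norm (\<lambda>x. f x - g x)"
      using fourier_L1_contraction(2)[OF L2_diff[OF f gL2] Bochner_Integration.integrable_diff[OF int g(1)]]
      by (simp add: fourier_L1_diff[OF int g(1), abs_def])
    then have "\<bar>L2_norm (fourier_L1 f) - L2_norm (fourier_L1 g)\<bar> < e / 2"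
      using L2_norm_diff_triangle[OF fourier_L1_contraction(1)[OF f int] fourier_L1_contraction(1)[OF gL2 g(1)]] fg
      by simp
    moreover have "\<bar>L2_norm f - L2_norm g\<bar> < e / 2"
      using L2_norm_diff_triangle[OF f gL2] fg by simp
    ultimately show "L2_norm f \<le> L2_norm (fourier_L1 f) + e"
      using fourier_L1_isometry_continuous[OF g(1) M g(2)] by linarith
  qed
qed

section \<open>The Fourier transform on \<open>L\<^sup>2\<close>\<close>

text \<open>The indicator of a ball lies in L2 because balls have finite measure, and a product of
  two L2 functions is integrable.\<close>

lemma L2_integrable_cball:
  fixes f :: "'a::euclidean_space \<Rightarrow> complex"
  assumes "f \<in> L2"
  shows "integrable lborel (\<lambda>x. indicator (cball 0 r) x * f x)"
proof -
  have "integrable lborel (\<lambda>x::'a. indicator (cball 0 r) x :: complex)"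
    by (rule integrable_real_indicator[THEN complex_of_real_integrable_eq[THEN iffD2], simplified of_real_indicator])
      (simp_all add: emeasure_bounded_finite[unfolded infinity_ennreal_def])
  then have "(\<lambda>x::'a. indicator (cball 0 r) x :: complex) \<in> L2"
    by (rule L2_of_bounded_integrable[where M = 1]) (simp add: indicator_def)
  then show ?thesis by (rule L2_mult_integrable[OF _ assms])
qed

lemma L2_truncate: "f \<in> L2 \<Longrightarrow> (\<lambda>x. indicator (cball 0 r) x * f x) \<in> L2"
  by (rule L2_indicator) simp_all

lemma L2_truncate_tendsto:
  assumes f: "f \<in> L2"
  shows "(\<lambda>n. L2_norm (\<lambda>x. f x - indicator (cball 0 (real n)) x * f x)) \<longlonglongrightarrow> 0"
proof (rule L2_norm_dominated_convergence[OF _ f])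
  show "(\<lambda>x. f x - indicator (cball 0 (real n)) x * f x) \<in> borel_measurable borel" for n
    by (intro L2_measurable L2_diff L2_truncate f)
  have "eventually (\<lambda>n. f x - indicator (cball 0 (real n)) x * f x = 0) sequentially" for x
  proof -
    obtain N where "norm x \<le> real N" using real_arch_simple by blast
    then show ?thesis by (intro eventually_sequentiallyI[of N]) auto
  qed
  then show "AE x in lborel. (\<lambda>n. f x - indicator (cball 0 (real n)) x * f x) \<longlonglongrightarrow> 0"
    by (intro AE_I2 tendsto_eventually)
qed (auto simp: indicator_def)

text \<open>Translates the convergence in the definition of \<open>fourier_L2\<close> into
  convergence in \<open>L2_norm\<close>.\<close>

lemma L2_tendsto_iff_nn_integral:
  assumes "g \<in> L2" "\<And>n. F n \<in> L2"
  shows "(\<lambda>n. \<integral>\<^sup>+x. ennreal ((norm (g x - F n x))\<^sup>2) \<partial>lborel) \<longlonglongrightarrow> 0 \<longleftrightarrow>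
    (\<lambda>n. L2_norm (\<lambda>x. g x - F n x)) \<longlonglongrightarrow> 0"
proof -
  have "(\<lambda>n. (L2_norm (\<lambda>x. g x - F n x))\<^sup>2) \<longlonglongrightarrow> 0 \<longleftrightarrow> (\<lambda>n. L2_norm (\<lambda>x. g x - F n x)) \<longlonglongrightarrow> 0"
  proof
    assume "(\<lambda>n. (L2_norm (\<lambda>x. g x - F n x))\<^sup>2) \<longlonglongrightarrow> 0"
    from tendsto_real_sqrt[OF this] show "(\<lambda>n. L2_norm (\<lambda>x. g x - F n x)) \<longlonglongrightarrow> 0" by simp
  qed (auto intro!: tendsto_eq_intros)
  then show ?thesis
    by (simp add: L2_nn_integral[OF L2_diff[OF assms]] ennreal_tendsto_0_iff)
qed

lemma L2_limit_unique:
  assumes g: "g \<in> L2" and h: "h \<in> L2" and F: "\<And>n. F n \<in> L2"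
    and "(\<lambda>n. L2_norm (\<lambda>x. g x - F n x)) \<longlonglongrightarrow> 0" "(\<lambda>n. L2_norm (\<lambda>x. h x - F n x)) \<longlonglongrightarrow> 0"
  shows "AE x in lborel. g x = h x"
proof -
  have "(\<lambda>n. L2_norm (\<lambda>x. g x - F n x) + L2_norm (\<lambda>x. h x - F n x)) \<longlonglongrightarrow> 0 + 0"
    by (intro tendsto_add assms)
  moreover have "L2_norm (\<lambda>x. g x - h x) \<le> L2_norm (\<lambda>x. g x - F n x) + L2_norm (\<lambda>x. h x - F n x)" for n
    using L2_norm_triangle_diff[OF g F h] L2_norm_minus_commute[of h "F n"] by simp
  ultimately have "L2_norm (\<lambda>x. g x - h x) \<le> 0"
    by (intro LIMSEQ_le_const) auto
  then have "L2_norm (\<lambda>x. g x - h x) = 0" by (intro antisym) auto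
  from L2_norm_eq_0[OF L2_diff[OF g h] this] show ?thesis by simp
qed

section \<open>The limit of the truncated transforms\<close>

abbreviation fourier_trunc :: "nat \<Rightarrow> ('a::euclidean_space \<Rightarrow> complex) \<Rightarrow> 'a \<Rightarrow> complex" where
  "fourier_trunc n f \<equiv> fourier_L1 (\<lambda>x. indicator (cball 0 (real n)) x * f x)"

lemma fourier_trunc_L2: "f \<in> L2 \<Longrightarrow> fourier_trunc n f \<in> L2"
  by (intro fourier_L1_contraction L2_truncate L2_integrable_cball)

lemma L2_norm_fourier_L1_diff:
  assumes "f \<in> L2" "g \<in> L2" "integrable lborel f" "integrable lborel g"
  shows "L2_norm (\<lambda>\<xi>. fourier_L1 f \<xi> - fourier_L1 g \<xi>) = L2_norm (\<lambda>x. f x - g x)"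
  using fourier_L1_Plancherel[OF L2_diff[OF assms(1,2)] Bochner_Integration.integrable_diff[OF assms(3,4)]]
  by (simp add: fourier_L1_diff[OF assms(3,4), abs_def])

text \<open>The truncations of f are Cauchy in L2, and the isometry passes this on to their
  transforms. Completeness then gives a limit, so the choice in \<open>fourier_L2\<close> has a
  witness.\<close>

lemma
  fixes f :: "'a::euclidean_space \<Rightarrow> complex"
  assumes f: "f \<in> L2"
  shows fourier_L2_in_L2: "fourier_L2 f \<in> L2"
    and fourier_trunc_tendsto: "(\<lambda>n. L2_norm (\<lambda>\<xi>. fourier_L2 f \<xi> - fourier_trunc n f \<xi>)) \<longlonglongrightarrow> 0"
proof -
  note tendsto_iff = L2_tendsto_iff_nn_integral[of _ "\<lambda>n. fourier_trunc n f", OF _ fourier_trunc_L2[OF f]]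
  let ?t = "\<lambda>n x. indicator (cball 0 (real n)) x * f x"
  have "\<exists>N. \<forall>m\<ge>N. \<forall>n\<ge>N. L2_norm (\<lambda>\<xi>. fourier_trunc m f \<xi> - fourier_trunc n f \<xi>) < e" if "0 < e" for e
  proof -
    have "eventually (\<lambda>n. L2_norm (\<lambda>x. f x - ?t n x) < e / 2) sequentially"
      using that by (intro order_tendstoD(2)[OF L2_truncate_tendsto[OF f]]) simp
    then obtain N where N: "\<And>n. n \<ge> N \<Longrightarrow> L2_norm (\<lambda>x. f x - ?t n x) < e / 2"
      by (auto simp: eventually_sequentially)
    have "L2_norm (\<lambda>\<xi>. fourier_trunc m f \<xi> - fourier_trunc n f \<xi>) < e" if "m \<ge> N" "n \<ge> N" for m n
    proof -
      have "L2_norm (\<lambda>\<xi>. fourier_trunc m f \<xi> - fourier_trunc n f \<xi>) = L2_norm (\<lambda>x. ?t m x - ?t n x)"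
        by (intro L2_norm_fourier_L1_diff L2_truncate L2_integrable_cball f)
      also have "\<dots> \<le> L2_norm (\<lambda>x. ?t m x - f x) + L2_norm (\<lambda>x. f x - ?t n x)"
        by (intro L2_norm_triangle_diff L2_truncate f)
      also have "L2_norm (\<lambda>x. ?t m x - f x) = L2_norm (\<lambda>x. f x - ?t m x)"
        by (rule L2_norm_minus_commute)
      finally show ?thesis using N[OF that(1)] N[OF that(2)] by linarith
    qed
    then show ?thesis by blast
  qed
  then obtain g where "g \<in> L2" "(\<lambda>n. L2_norm (\<lambda>x. g x - fourier_trunc n f x)) \<longlonglongrightarrow> 0"
    using L2_complete[of "\<lambda>n. fourier_trunc n f"] fourier_trunc_L2[OF f] by blast
  then have "\<exists>g. g \<in> L2 \<and>
     (\<lambda>n. \<integral>\<^sup>+\<xi>. ennreal ((norm (g \<xi> - fourier_trunc n f \<xi>))\<^sup>2) \<partial>lborel) \<longlonglongrightarrow> 0"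
    using tendsto_iff by blast
  from someI_ex[OF this] have "fourier_L2 f \<in> L2 \<and>
     (\<lambda>n. \<integral>\<^sup>+\<xi>. ennreal ((norm (fourier_L2 f \<xi> - fourier_trunc n f \<xi>))\<^sup>2) \<partial>lborel) \<longlonglongrightarrow> 0"
    unfolding fourier_L2_def .
  then show "fourier_L2 f \<in> L2" "(\<lambda>n. L2_norm (\<lambda>\<xi>. fourier_L2 f \<xi> - fourier_trunc n f \<xi>)) \<longlonglongrightarrow> 0"
    using tendsto_iff by blast+
qed

lemma L2_norm_tendsto:
  assumes f: "f \<in> L2" and F: "\<And>n. F n \<in> L2" and lim: "(\<lambda>n. L2_norm (\<lambda>x. f x - F n x)) \<longlonglongrightarrow> 0"
  shows "(\<lambda>n. L2_norm (F n)) \<longlonglongrightarrow> L2_norm f"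
proof (rule LIM_zero_cancel, rule Lim_null_comparison[OF always_eventually lim], rule allI)
  show "norm (L2_norm (F n) - L2_norm f) \<le> L2_norm (\<lambda>x. f x - F n x)" for n
    using L2_norm_diff_triangle[OF f F] by (simp add: abs_minus_commute)
qed

text \<open>The norms of the truncated transforms equal those of the truncations of f, so their
  limit can be computed in two ways.\<close>

theorem fourier_L2_Plancherel:
  assumes f: "f \<in> L2"
  shows "L2_norm (fourier_L2 f) = L2_norm f"
proof (rule LIMSEQ_unique)
  show "(\<lambda>n. L2_norm (fourier_trunc n f)) \<longlonglongrightarrow> L2_norm (fourier_L2 f)"
    by (intro L2_norm_tendsto fourier_L2_in_L2 fourier_trunc_L2 fourier_trunc_tendsto f)
  have "L2_norm (fourier_trunc n f) = L2_norm (\<lambda>x. indicator (cball 0 (real n)) x * f x)" for n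
    by (intro fourier_L1_Plancherel L2_truncate L2_integrable_cball f)
  then show "(\<lambda>n. L2_norm (fourier_trunc n f)) \<longlonglongrightarrow> L2_norm f"
    by (simp only:) (intro L2_norm_tendsto L2_truncate L2_truncate_tendsto f)
qed

text \<open>Each value of \<open>fourier_L2\<close> is a chosen representative, so linearity holds
  only almost everywhere. It follows from uniqueness of L2 limits, because truncated transforms are
  linear.\<close>

lemma fourier_L2_diff:
  assumes f: "f \<in> L2" and g: "g \<in> L2"
  shows "AE \<xi> in lborel. fourier_L2 (\<lambda>x. f x - g x) \<xi> = fourier_L2 f \<xi> - fourier_L2 g \<xi>"
proof (rule L2_limit_unique)
  let ?D = "\<lambda>n \<xi>. fourier_trunc n f \<xi> - fourier_trunc n g \<xi>"
  note fL2 = fourier_L2_in_L2[OF f] fourier_L2_in_L2[OF g]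
  have D: "fourier_trunc n (\<lambda>x. f x - g x) = ?D n" for n
    by (simp add: right_diff_distrib fun_eq_iff fourier_L1_diff L2_integrable_cball f g)
  show "fourier_L2 (\<lambda>x. f x - g x) \<in> L2"
    by (intro fourier_L2_in_L2 L2_diff f g)
  show "(\<lambda>\<xi>. fourier_L2 f \<xi> - fourier_L2 g \<xi>) \<in> L2"
    by (intro L2_diff fL2)
  show "?D n \<in> L2" for n
    by (intro L2_diff fourier_trunc_L2 f g)
  show "(\<lambda>n. L2_norm (\<lambda>\<xi>. fourier_L2 (\<lambda>x. f x - g x) \<xi> - ?D n \<xi>)) \<longlonglongrightarrow> 0"
    using fourier_trunc_tendsto[OF L2_diff[OF f g]] unfolding D .
  let ?a = "\<lambda>n. L2_norm (\<lambda>\<xi>. fourier_L2 f \<xi> - fourier_trunc n f \<xi>)"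
  let ?b = "\<lambda>n. L2_norm (\<lambda>\<xi>. fourier_L2 g \<xi> - fourier_trunc n g \<xi>)"
  show "(\<lambda>n. L2_norm (\<lambda>\<xi>. fourier_L2 f \<xi> - fourier_L2 g \<xi> - ?D n \<xi>)) \<longlonglongrightarrow> 0"
  proof (rule Lim_null_comparison[OF always_eventually], rule allI)
    show "(\<lambda>n. ?a n + ?b n) \<longlonglongrightarrow> 0"
      using tendsto_add[OF fourier_trunc_tendsto[OF f] fourier_trunc_tendsto[OF g]] by simp
    fix n
    have "L2_norm (\<lambda>\<xi>. (fourier_L2 f \<xi> - fourier_trunc n f \<xi>) + (fourier_trunc n g \<xi> - fourier_L2 g \<xi>))
        \<le> ?a n + L2_norm (\<lambda>\<xi>. fourier_trunc n g \<xi> - fourier_L2 g \<xi>)"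
      by (intro L2_norm_triangle L2_diff fL2 fourier_trunc_L2 f g)
    also have "(\<lambda>\<xi>. (fourier_L2 f \<xi> - fourier_trunc n f \<xi>) + (fourier_trunc n g \<xi> - fourier_L2 g \<xi>)) =
        (\<lambda>\<xi>. fourier_L2 f \<xi> - fourier_L2 g \<xi> - ?D n \<xi>)"
      by (simp add: fun_eq_iff)
    also have "L2_norm (\<lambda>\<xi>. fourier_trunc n g \<xi> - fourier_L2 g \<xi>) = ?b n"
      by (rule L2_norm_minus_commute)
    finally show "norm (L2_norm (\<lambda>\<xi>. fourier_L2 f \<xi> - fourier_L2 g \<xi> - ?D n \<xi>)) \<le> ?a n + ?b n"
      by simp
  qed
qed

section \<open>Adjointness and inversion\<close>

lemma L2_mult_tendsto:
  assumes f: "f \<in> L2" and F: "\<And>n. F n \<in> L2" and h: "h \<in> L2"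
    and lim: "(\<lambda>n. L2_norm (\<lambda>x. f x - F n x)) \<longlonglongrightarrow> 0"
  shows "(\<lambda>n. LINT x|lborel. F n x * h x) \<longlonglongrightarrow> (LINT x|lborel. f x * h x)"
proof (rule LIM_zero_cancel, rule Lim_null_comparison[OF always_eventually], rule allI)
  show "(\<lambda>n. L2_norm (\<lambda>x. f x - F n x) * L2_norm h) \<longlonglongrightarrow> 0"
    using tendsto_mult_right[OF lim, of "L2_norm h"] by simp
  fix n
  have "(LINT x|lborel. F n x * h x) - (LINT x|lborel. f x * h x) = - (LINT x|lborel. (f x - F n x) * h x)"
    using L2_mult_integrable[OF F h] L2_mult_integrable[OF f h] by (simp add: left_diff_distrib)
  then show "norm ((LINT x|lborel. F n x * h x) - (LINT x|lborel. f x * h x)) \<le>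
      L2_norm (\<lambda>x. f x - F n x) * L2_norm h"
    using L2_Cauchy_Schwarz(2)[OF L2_diff[OF f F] h] by (simp only: norm_minus_cancel)
qed

text \<open>The multiplication formula holds for the truncations of f and survives the limit because
  the pairing is continuous in L2.\<close>

lemma fourier_L2_adjoint:
  assumes f: "f \<in> L2" and h: "h \<in> L2" "integrable lborel h"
  shows "(LINT \<xi>|lborel. fourier_L2 f \<xi> * h \<xi>) = (LINT x|lborel. f x * fourier_L1 h x)"
proof (rule LIMSEQ_unique)
  show "(\<lambda>n. LINT \<xi>|lborel. fourier_trunc n f \<xi> * h \<xi>) \<longlonglongrightarrow> (LINT \<xi>|lborel. fourier_L2 f \<xi> * h \<xi>)"
    by (intro L2_mult_tendsto fourier_L2_in_L2 fourier_trunc_L2 fourier_trunc_tendsto f h)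
  have "(\<lambda>n. LINT x|lborel. (indicator (cball 0 (real n)) x * f x) * fourier_L1 h x) \<longlonglongrightarrow>
      (LINT x|lborel. f x * fourier_L1 h x)"
    by (intro L2_mult_tendsto L2_truncate L2_truncate_tendsto fourier_L1_contraction f h)
  then show "(\<lambda>n. LINT \<xi>|lborel. fourier_trunc n f \<xi> * h \<xi>) \<longlonglongrightarrow> (LINT x|lborel. f x * fourier_L1 h x)"
    by (simp only: fourier_L1_mult_swap[OF L2_integrable_cball[OF f] h(2)])
qed

lemma L2_norm_diff_square:
  assumes f: "f \<in> L2" and g: "g \<in> L2"
  shows "(L2_norm (\<lambda>x. f x - g x))\<^sup>2 =
    (L2_norm f)\<^sup>2 + (L2_norm g)\<^sup>2 - 2 * Re (LINT x|lborel. f x * cnj (g x))"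
proof -
  have int: "integrable lborel (\<lambda>x. Re (f x * cnj (g x)))"
    by (intro integrable_Re L2_mult_integrable f L2_cnj g)
  have "(norm (f x - g x))\<^sup>2 = (norm (f x))\<^sup>2 + (norm (g x))\<^sup>2 - 2 * Re (f x * cnj (g x))" for x
    unfolding cmod_power2 by (simp add: power2_eq_square algebra_simps)
  then have "(L2_norm (\<lambda>x. f x - g x))\<^sup>2 =
      (LINT x|lborel. (norm (f x))\<^sup>2 + (norm (g x))\<^sup>2 - 2 * Re (f x * cnj (g x)))"
    by (simp only: L2_norm_square)
  also have "\<dots> = (L2_norm f)\<^sup>2 + (L2_norm g)\<^sup>2 - 2 * (LINT x|lborel. Re (f x * cnj (g x)))"
    using int f g by (simp add: L2_norm_square L2_square_integrable del: times_complex.simps)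
  also have "(LINT x|lborel. Re (f x * cnj (g x))) = Re (LINT x|lborel. f x * cnj (g x))"
    by (intro integral_Re L2_mult_integrable f L2_cnj g)
  finally show ?thesis .
qed

text \<open>The isometry \<open>fourier_L2\<close> inverts the reflected transform \<open>S\<close>, since
  \<open>\<langle>fourier_L2 (S h), h\<rangle> = \<langle>S h, S h\<rangle> = \<parallel>h\<parallel>\<^sup>2\<close>.\<close>

lemma fourier_L2_inversion:
  fixes h :: "'a::euclidean_space \<Rightarrow> complex"
  assumes h: "h \<in> L2" "integrable lborel h"
  shows "\<exists>f \<in> L2. AE \<xi> in lborel. fourier_L2 f \<xi> = h \<xi>"
proof
  define f where "f x = fourier_L1 h (- x)" for x
  have f: "f \<in> L2" "L2_norm f = L2_norm h"
    using L2_affine[OF fourier_L1_contraction(1)[OF h], of "-1" 0] fourier_L1_Plancherel[OF h]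
    by (simp_all add: f_def[abs_def])
  then show "f \<in> L2" by simp
  \<comment> \<open>Conjugating h conjugates and reflects its transform, so adjointness turns the
    pairing with h into the squared norm of f.\<close>
  have "fourier_L1 (\<lambda>\<xi>. cnj (h \<xi>)) x = cnj (f x)" for x
    unfolding f_def fourier_L1_wave Bochner_Integration.integral_cnj[symmetric]
    by (simp add: cnj_wave)
  then have "(LINT \<xi>|lborel. fourier_L2 f \<xi> * cnj (h \<xi>)) = (LINT x|lborel. f x * cnj (f x))"
    using fourier_L2_adjoint[OF f(1) L2_cnj[OF h(1)]] h(2) by simp
  \<comment> \<open>Both squared norms and the pairing all equal the squared norm of h, so the
    expanded square vanishes.\<close>
  then have "(L2_norm (\<lambda>\<xi>. fourier_L2 f \<xi> - h \<xi>))\<^sup>2 = 0"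
    unfolding L2_norm_diff_square[OF fourier_L2_in_L2[OF f(1)] h(1)]
    by (simp add: integral_mult_cnj fourier_L2_Plancherel f)
  then show "AE \<xi> in lborel. fourier_L2 f \<xi> = h \<xi>"
    using L2_norm_eq_0[OF L2_diff[OF fourier_L2_in_L2[OF f(1)] h(1)]] by simp
qed

section \<open>The spectral projections\<close>

text \<open>Restricted to a ball, the transform is both integrable and in L2, so inversion applies
  and the choice in \<open>inv_fourier_L2\<close> has a witness.\<close>

lemma
  fixes f :: "'a::euclidean_space \<Rightarrow> complex"
  assumes f: "f \<in> L2"
  shows proj_low_L2: "proj_low \<omega> f \<in> L2"
    and fourier_proj_low: "AE \<xi> in lborel. fourier_L2 (proj_low \<omega> f) \<xi> = indicator {\<xi>. norm \<xi> \<le> \<omega>} \<xi> * fourier_L2 f \<xi>"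
proof -
  let ?h = "\<lambda>\<xi>. indicator {\<xi>. norm \<xi> \<le> \<omega>} \<xi> * fourier_L2 f \<xi>"
  have ball: "{\<xi>::'a. norm \<xi> \<le> \<omega>} = cball 0 \<omega>" by auto
  have "?h \<in> L2" "integrable lborel ?h"
    unfolding ball by (intro L2_truncate L2_integrable_cball fourier_L2_in_L2 f)+
  then have "\<exists>g. g \<in> L2 \<and> (AE \<xi> in lborel. fourier_L2 g \<xi> = ?h \<xi>)"
    using fourier_L2_inversion by blast
  from someI_ex[OF this] show "proj_low \<omega> f \<in> L2"
    "AE \<xi> in lborel. fourier_L2 (proj_low \<omega> f) \<xi> = ?h \<xi>"
    unfolding proj_low_def inv_fourier_L2_def by auto
qed

text \<open>On the Fourier side the complementary projection multiplies by 1 minus the indicator of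
  the closed ball; Plancherel carries the norm across.\<close>

lemma L2_norm_proj_high:
  fixes f :: "'a::euclidean_space \<Rightarrow> complex"
  assumes f: "f \<in> L2"
  shows "L2_norm (proj_high \<omega> f) = L2_norm (\<lambda>\<xi>. indicator {\<xi>. norm \<xi> > \<omega>} \<xi> * fourier_L2 f \<xi>)"
proof -
  note low = proj_low_L2[OF f, of \<omega>]
  have "L2_norm (proj_high \<omega> f) = L2_norm (fourier_L2 (\<lambda>x. f x - proj_low \<omega> f x))"
    unfolding proj_high_def by (intro fourier_L2_Plancherel[symmetric] L2_diff f low)
  also have "\<dots> = L2_norm (\<lambda>\<xi>. indicator {\<xi>. norm \<xi> > \<omega>} \<xi> * fourier_L2 f \<xi>)"
  proof (intro L2_norm_AE_cong fourier_L2_in_L2 L2_diff f low L2_indicator)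
    show "AE \<xi> in lborel. fourier_L2 (\<lambda>x. f x - proj_low \<omega> f x) \<xi> =
        indicator {\<xi>. norm \<xi> > \<omega>} \<xi> * fourier_L2 f \<xi>"
      using fourier_L2_diff[OF f low] fourier_proj_low[OF f, of \<omega>]
      by eventually_elim (auto simp: indicator_def)
  qed measurable
  finally show ?thesis .
qed

section \<open>The frequency cutoff\<close>

text \<open>Dominated convergence with bound |u|. The limit set is left general to cover both radii
  tending to infinity and radii decreasing to an infimum.\<close>

lemma tail_integral_tendsto:
  fixes u :: "'a::euclidean_space \<Rightarrow> real"
  assumes u: "integrable lborel u"
    and lim: "\<And>\<xi>::'a. (\<lambda>n. indicator {\<xi>. norm \<xi> > R n} \<xi> :: real) \<longlonglongrightarrow> indicator A \<xi>"
    and A: "A \<in> sets borel"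
  shows "(\<lambda>n. LINT \<xi>:{\<xi>. norm \<xi> > R n}|lborel. u \<xi>) \<longlonglongrightarrow> (LINT \<xi>:A|lborel. u \<xi>)"
  unfolding set_lebesgue_integral_def
proof (rule integral_dominated_convergence[where w = "\<lambda>\<xi>. norm (u \<xi>)"])
  show "AE \<xi> in lborel. (\<lambda>n. indicat_real {\<xi>. norm \<xi> > R n} \<xi> *\<^sub>R u \<xi>) \<longlonglongrightarrow> indicat_real A \<xi> *\<^sub>R u \<xi>"
    by (intro AE_I2 tendsto_scaleR lim tendsto_const)
qed (use u A in \<open>auto simp: indicator_def\<close>)

text \<open>The infimum in the definition of the cutoff is attained up to the constraint \<open>\<Omega> > 0\<close>, since
  the tail integral is continuous from the right.\<close>

lemma tail_integral_Inf:
  fixes u :: "'a::euclidean_space \<Rightarrow> real" and c K :: real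
  assumes u: "integrable lborel u" and zero: "K = 0 \<Longrightarrow> AE \<xi> in lborel. u \<xi> = 0" and K: "0 \<le> K"
  defines "S \<equiv> {\<Omega>. \<Omega> > 0 \<and> c * (LINT \<xi>:{\<xi>. norm \<xi> > \<Omega>}|lborel. u \<xi>) \<le> K}"
  shows "c * (LINT \<xi>:{\<xi>. norm \<xi> > Inf S}|lborel. u \<xi>) \<le> K"
proof -
  \<comment> \<open>The infimum of an empty set would carry no information. The tails tend to 0,
    which brings them below K only if K > 0; for K = 0 the function vanishes almost everywhere and
    any positive radius, such as 1, will do.\<close>
  have "S \<noteq> {}"
  proof (cases "K = 0")
    case True
    from zero[OF this] have "AE \<xi> in lborel. indicat_real {\<xi>. norm \<xi> > 1} \<xi> *\<^sub>R u \<xi> = 0"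
      by eventually_elim simp
    then have "(LINT \<xi>:{\<xi>. norm \<xi> > 1}|lborel. u \<xi>) = 0"
      unfolding set_lebesgue_integral_def by (rule integral_eq_zero_AE)
    then have "1 \<in> S" using K by (simp add: S_def)
    then show ?thesis by auto
  next
    case False
    have "(\<lambda>n. c * (LINT \<xi>:{\<xi>. norm \<xi> > real n}|lborel. u \<xi>)) \<longlonglongrightarrow> c * (LINT \<xi>:{}|lborel. u \<xi>)"
    proof (intro tendsto_mult tendsto_const tail_integral_tendsto u)
      show "(\<lambda>n. indicat_real {\<xi>. norm \<xi> > real n} \<xi>) \<longlonglongrightarrow> indicator {} \<xi>" for \<xi> :: 'a
      proof (rule tendsto_eventually)
        obtain N where "norm \<xi> \<le> real N" using real_arch_simple by blast
        then show "eventually (\<lambda>n. indicat_real {\<xi>. norm \<xi> > real n} \<xi> = indicator {} \<xi>) sequentially"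
          by (intro eventually_sequentiallyI[of N]) auto
      qed
    qed simp
    then have "(\<lambda>n. c * (LINT \<xi>:{\<xi>. norm \<xi> > real n}|lborel. u \<xi>)) \<longlonglongrightarrow> 0"
      by (simp add: set_lebesgue_integral_def)
    then have "eventually (\<lambda>n. c * (LINT \<xi>:{\<xi>. norm \<xi> > real n}|lborel. u \<xi>) < K) sequentially"
      using K False by (intro order_tendstoD(2)) auto
    then have "eventually (\<lambda>n. real n \<in> S) sequentially"
      using eventually_gt_at_top[of 0] by eventually_elim (auto simp: S_def)
    from eventually_happens'[OF sequentially_bot this] show ?thesis by auto
  qed
  have "bdd_below S" unfolding S_def by (intro bdd_belowI[of _ 0]) auto
  have "\<exists>R\<in>S. R < Inf S + 1 / real (Suc n)" for n
    using \<open>S \<noteq> {}\<close> by (intro cInf_lessD) auto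
  then obtain R where R: "\<And>n. R n \<in> S" "\<And>n. R n < Inf S + 1 / real (Suc n)" by metis
  have ge: "Inf S \<le> R n" for n by (intro cInf_lower R \<open>bdd_below S\<close>)
  have "R \<longlonglongrightarrow> Inf S"
  proof (rule tendsto_sandwich[OF always_eventually always_eventually tendsto_const])
    show "(\<lambda>n. Inf S + 1 / real (Suc n)) \<longlonglongrightarrow> Inf S"
      using tendsto_add[OF tendsto_const LIMSEQ_Suc[OF lim_1_over_n], of "Inf S"] by simp
  qed (intro allI ge less_imp_le[OF R(2)])+
  then have "(\<lambda>n. c * (LINT \<xi>:{\<xi>. norm \<xi> > R n}|lborel. u \<xi>)) \<longlonglongrightarrow> c * (LINT \<xi>:{\<xi>. norm \<xi> > Inf S}|lborel. u \<xi>)"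
  proof (intro tendsto_mult tendsto_const tail_integral_tendsto u)
    show "(\<lambda>n. indicat_real {\<xi>. norm \<xi> > R n} \<xi>) \<longlonglongrightarrow> indicator {\<xi>. norm \<xi> > Inf S} \<xi>" for \<xi> :: 'a
    \<comment> \<open>As \<open>R n\<close> is at least \<open>Inf S\<close>, points with norm at
      most \<open>Inf S\<close> are in no tail; points of larger norm are eventually in all. The
      strict inequality in the tail is what gives continuity from the right.\<close>
    proof (rule tendsto_eventually, cases "norm \<xi> > Inf S")
      case True
      from order_tendstoD(2)[OF \<open>R \<longlonglongrightarrow> Inf S\<close> this]
      show "eventually (\<lambda>n. indicat_real {\<xi>. norm \<xi> > R n} \<xi> = indicator {\<xi>. norm \<xi> > Inf S} \<xi>) sequentially"
        by eventually_elim (simp add: True)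
    next
      case False
      then have "\<not> norm \<xi> > R n" for n using ge[of n] by simp
      then show "eventually (\<lambda>n. indicat_real {\<xi>. norm \<xi> > R n} \<xi> = indicator {\<xi>. norm \<xi> > Inf S} \<xi>) sequentially"
        using False by simp
    qed
  qed measurable
  then show ?thesis
    by (rule LIMSEQ_le_const2) (use R(1) in \<open>auto simp: S_def\<close>)
qed

text \<open>The squared envelope is exactly the weight in \<open>cutoff\<close>. The tail energy of
  g is therefore at most the weighted tail of f, which \<open>tail_integral_Inf\<close> bounds at
  the infimum itself.\<close>

lemma L2_norm_output_tail:
  fixes f g :: "'a::euclidean_space \<Rightarrow> complex"
  assumes f: "f \<in> L2" and "0 < \<epsilon>"
    and env: "has_envelope C L k" and out: "is_cnn_output L k f g"
  shows "L2_norm (\<lambda>\<xi>. indicator {\<xi>. norm \<xi> > cutoff C L \<epsilon> f} \<xi> * fourier_L2 g \<xi>) \<le> sqrt \<epsilon> * L2_norm f"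
proof (rule power2_le_imp_le)
  let ?A = "{\<xi>::'a. norm \<xi> > cutoff C L \<epsilon> f}"
  let ?u = "\<lambda>\<xi>. (norm (fourier_L2 f \<xi>))\<^sup>2 / (1 + norm \<xi>) ^ (2 * L)"
  have g: "g \<in> L2" and gf: "AE \<xi> in lborel. fourier_L2 g \<xi> = freq_response L k \<xi> * fourier_L2 f \<xi>"
    using out by (auto simp: is_cnn_output_def)
  have F: "fourier_L2 f \<in> L2" by (rule fourier_L2_in_L2[OF f])
  have [measurable]: "fourier_L2 f \<in> borel_measurable borel" by (rule L2_measurable[OF F])
  have u: "integrable lborel ?u"
  proof (rule Bochner_Integration.integrable_bound[OF L2_square_integrable[OF F]])
    show "AE \<xi> in lborel. norm (?u \<xi>) \<le> norm ((norm (fourier_L2 f \<xi>))\<^sup>2)"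
      by (simp add: divide_le_eq mult_le_cancel_left1 one_le_power)
  qed simp
  have tail: "C ^ (2 * L) * (LINT \<xi>:?A|lborel. ?u \<xi>) \<le> \<epsilon> * (L2_norm f)\<^sup>2"
    unfolding cutoff_def
  proof (rule tail_integral_Inf[OF u])
    \<comment> \<open>If the budget is zero, then f has norm 0 and, by Plancherel, its transform
      vanishes almost everywhere.\<close>
    assume "\<epsilon> * (L2_norm f)\<^sup>2 = 0"
    then have "L2_norm (fourier_L2 f) = 0" using \<open>0 < \<epsilon>\<close> fourier_L2_Plancherel[OF f] by simp
    from L2_norm_eq_0[OF F this] show "AE \<xi> in lborel. ?u \<xi> = 0"
      by eventually_elim simp
  qed (use \<open>0 < \<epsilon>\<close> in simp)
  have "(L2_norm (\<lambda>\<xi>. indicator ?A \<xi> * fourier_L2 g \<xi>))\<^sup>2 \<le>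
      (LINT \<xi>|lborel. C ^ (2 * L) * (indicat_real ?A \<xi> *\<^sub>R ?u \<xi>))"
    unfolding L2_norm_square
  proof (rule integral_mono_AE)
    show "integrable lborel (\<lambda>\<xi>. (norm (indicator ?A \<xi> * fourier_L2 g \<xi>))\<^sup>2)"
      by (intro L2_square_integrable L2_indicator fourier_L2_in_L2 g) measurable
    show "integrable lborel (\<lambda>\<xi>. C ^ (2 * L) * (indicat_real ?A \<xi> *\<^sub>R ?u \<xi>))"
      by (intro integrable_mult_right integrable_mult_indicator u) measurable
    show "AE \<xi> in lborel. (norm (indicator ?A \<xi> * fourier_L2 g \<xi>))\<^sup>2 \<le> C ^ (2 * L) * (indicat_real ?A \<xi> *\<^sub>R ?u \<xi>)"
      using gf
    proof eventually_elim
      case (elim \<xi>)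
      have "(norm (freq_response L k \<xi>))\<^sup>2 \<le> (C ^ L / (1 + norm \<xi>) ^ L)\<^sup>2"
        using env by (intro power_mono) (auto simp: has_envelope_def)
      also have "\<dots> = C ^ (2 * L) / (1 + norm \<xi>) ^ (2 * L)"
        by (simp add: power_divide power_even_eq)
      finally have "(norm (freq_response L k \<xi>))\<^sup>2 * (norm (fourier_L2 f \<xi>))\<^sup>2 \<le>
          C ^ (2 * L) / (1 + norm \<xi>) ^ (2 * L) * (norm (fourier_L2 f \<xi>))\<^sup>2"
        by (rule mult_right_mono) simp
      then show ?case
        unfolding elim by (auto simp: indicator_def norm_mult power_mult_distrib)
    qed
  qed
  also have "\<dots> = C ^ (2 * L) * (LINT \<xi>:?A|lborel. ?u \<xi>)"
    unfolding set_lebesgue_integral_def by (rule integral_mult_right_zero)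
  also have "\<dots> \<le> (sqrt \<epsilon> * L2_norm f)\<^sup>2"
    using tail \<open>0 < \<epsilon>\<close> by (simp add: power_mult_distrib)
  finally show "(L2_norm (\<lambda>\<xi>. indicator ?A \<xi> * fourier_L2 g \<xi>))\<^sup>2 \<le> (sqrt \<epsilon> * L2_norm f)\<^sup>2" .
qed (use \<open>0 < \<epsilon>\<close> in simp)

theorem theorem2:
  fixes C \<epsilon> \<omega>\<^sub>c :: real and L :: nat
    and Y0 Y Y_low Y_high Yt :: "real ^ 'd \<Rightarrow> complex"
    and k :: "nat \<Rightarrow> real ^ 'd \<Rightarrow> complex"
  assumes "L \<ge> 1" and "C > 0" and "0 < \<epsilon>" and "\<epsilon> < 1"
    and "Y0 \<in> L2"
    and "\<omega>\<^sub>c = cutoff C L \<epsilon> Y0"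
    and "Y \<in> L2"
    and "Y_low = proj_low \<omega>\<^sub>c Y"
    and "Y_high = proj_high \<omega>\<^sub>c Y"
    and "\<And>l. l \<in> {1..L} \<Longrightarrow> cnn_kernel (k l)"
    and "has_envelope C L k"
    and "is_cnn_output L k Y0 Yt"
  shows "L2_norm (\<lambda>x. Y x - Yt x) \<ge> max (L2_norm Y_high - sqrt \<epsilon> * L2_norm Y0) 0"
proof -
  let ?A = "\<lambda>\<xi>::real ^ 'd. indicator {\<xi>. norm \<xi> > \<omega>\<^sub>c} \<xi> :: complex"
  have Yt: "Yt \<in> L2" using \<open>is_cnn_output L k Y0 Yt\<close> by (simp add: is_cnn_output_def)
  note F = fourier_L2_in_L2[OF \<open>Y \<in> L2\<close>] fourier_L2_in_L2[OF Yt]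
  have AF: "(\<lambda>\<xi>. ?A \<xi> * fourier_L2 Y \<xi>) \<in> L2" "(\<lambda>\<xi>. ?A \<xi> * fourier_L2 Yt \<xi>) \<in> L2"
    using F by (auto intro!: L2_indicator)
  have "L2_norm Y_high - sqrt \<epsilon> * L2_norm Y0 \<le>
      L2_norm (\<lambda>\<xi>. ?A \<xi> * fourier_L2 Y \<xi>) - L2_norm (\<lambda>\<xi>. ?A \<xi> * fourier_L2 Yt \<xi>)"
    using L2_norm_proj_high[OF \<open>Y \<in> L2\<close>, of \<omega>\<^sub>c]
      L2_norm_output_tail[OF \<open>Y0 \<in> L2\<close> \<open>0 < \<epsilon>\<close> \<open>has_envelope C L k\<close> \<open>is_cnn_output L k Y0 Yt\<close>]
      \<open>\<omega>\<^sub>c = cutoff C L \<epsilon> Y0\<close> \<open>Y_high = proj_high \<omega>\<^sub>c Y\<close>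
    by simp
  also have "\<dots> \<le> L2_norm (\<lambda>\<xi>. ?A \<xi> * fourier_L2 Y \<xi> - ?A \<xi> * fourier_L2 Yt \<xi>)"
    using L2_norm_diff_triangle[OF AF] by simp
  \<comment> \<open>Dropping the restriction to high frequencies can only increase the norm.\<close>
  also have "\<dots> \<le> L2_norm (\<lambda>\<xi>. fourier_L2 Y \<xi> - fourier_L2 Yt \<xi>)"
    unfolding right_diff_distrib[symmetric]
    by (rule L2_indicator(2)[OF L2_diff[OF F]]) measurable
  also have "\<dots> = L2_norm (fourier_L2 (\<lambda>x. Y x - Yt x))"
    using fourier_L2_diff[OF \<open>Y \<in> L2\<close> Yt]
    by (intro L2_norm_AE_cong fourier_L2_in_L2 L2_diff F \<open>Y \<in> L2\<close> Yt) (auto elim: eventually_mono)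
  also have "\<dots> = L2_norm (\<lambda>x. Y x - Yt x)"
    by (intro fourier_L2_Plancherel L2_diff \<open>Y \<in> L2\<close> Yt)
  \<comment> \<open>The positive part comes for free because the error norm is nonnegative.\<close>
  finally show ?thesis by simp
qed

end
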